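(* Fix integers $m,n\ge 1$, the directed grid $G_{m,n}$ with source $s=(0,0)$ and sink $t=(m,n)$, a slope $a>0$ and a demand $q>0$. Call a chord $u\to v$ Braess-capable if there exist $b,c,d\ge 0$ such that, if every grid edge has latency $ax+b$ and the chord has latency $cx+d$, the resulting Braess Ratio exceeds $1$. Then a chord $u\to v$ is Braess-capable if and only if \[ V_{uv}<0\qquad\text{and}\qquad k>0 , \] where $k=\lambda(v)-\lambda(u)$ is the level gain of the chord.
   Context: Grid: $G_{m,n}=(V,E)$ is the directed graph with vertex set $V=\{0,\dots,m\}\times\{0,\dots,n\}$ and directed edges $(i,j)\to(i+1,j)$ for $i<m$ and $(i,j)\to(i,j+1)$ for $j<n$. Chord: an added directed edge $u\to v$ with $u,v\in V$, $u\ne v$, such that $uv$ is not an edge of the underlying undirected grid. The level of a vertex is $\lambda(i,j)=i+j$. Feasible flow (in the grid, or in the grid plus chord): a nonnegative number $f_e$ for each directed edge $e$, with flow conserved at every vertex other than $s,t$, and net outflow from $s$ and net inflow to $t$ both equal to $q$. Its cost is $C(f)=\sum_e f_e\ell_e(f_e)$, where $\ell_e$ is the latency function of $e$. User Equilibrium: a feasible flow, decomposable into flows along $s$-$t$ paths, such that every path carrying positive flow has latency (sum of $\ell_e(f_e)$ over its edges) no larger than that of any other $s$-$t$ path. By a classical theorem (Beckmann, McGuire, Winsten) these are exactly the minimizers over feasible flows of the Beckmann potential $Z(f)=\sum_e\int_0^{f_e}\ell_e(y)\,dy$; in the networks considered here the minimizer is unique. Braess Ratio: $BR=C_{\mathrm{new}}/C_{\mathrm{old}}$,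 where $C_{\mathrm{old}}$ is the cost of the User Equilibrium of $G_{m,n}$ and $C_{\mathrm{new}}$ is the cost of the User Equilibrium of $G_{m,n}$ with the chord added (same $s,t,q$). Electrical quantities: $\mathsf L$ is the weighted graph Laplacian of the underlying undirected grid in which every edge has resistance $a$ (diagonal entries $\deg/a$, off-diagonal entries $-1/a$ for adjacent vertices and $0$ otherwise), $\mathsf L^+$ is its Moore--Penrose pseudoinverse, $\mathbf e_w\in\mathbb R^{V}$ is the standard basis vector at $w$, and $V_{uv}=q(\mathbf e_s-\mathbf e_t)^{\mathsf T}\mathsf L^+(\mathbf e_u-\mathbf e_v)$. *)

theory Defs
  imports "Graph_Theory.Arc_Walk" "Jordan_Normal_Form.Matrix"
begin

section \<open>User equilibria in directed networks\<close>

text \<open>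
  A latency assignment \<open>lat\<close> maps each arc to its latency as a function of the flow on that arc;
  a flow maps each arc to a real number (only its values on \<open>arcs G\<close> matter).
\<close>

definition net_outflow :: "('a, 'b) pre_digraph \<Rightarrow> ('b \<Rightarrow> real) \<Rightarrow> 'a \<Rightarrow> real" where
  "net_outflow G f w = (\<Sum>e\<in>out_arcs G w. f e) - (\<Sum>e\<in>in_arcs G w. f e)"

definition feasible_flow ::
  "('a, 'b) pre_digraph \<Rightarrow> 'a \<Rightarrow> 'a \<Rightarrow> real \<Rightarrow> ('b \<Rightarrow> real) \<Rightarrow> bool" where
  "feasible_flow G s t q f \<longleftrightarrow>
     (\<forall>e\<in>arcs G. f e \<ge> 0) \<and>
     (\<forall>w\<in>verts G - {s, t}. net_outflow G f w = 0) \<and>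
     net_outflow G f s = q \<and> - net_outflow G f t = q"

definition flow_cost ::
  "('a, 'b) pre_digraph \<Rightarrow> ('b \<Rightarrow> real \<Rightarrow> real) \<Rightarrow> ('b \<Rightarrow> real) \<Rightarrow> real" where
  "flow_cost G lat f = (\<Sum>e\<in>arcs G. f e * lat e (f e))"

definition path_latency :: "('b \<Rightarrow> real \<Rightarrow> real) \<Rightarrow> ('b \<Rightarrow> real) \<Rightarrow> 'b awalk \<Rightarrow> real" where
  "path_latency lat f p = (\<Sum>e\<leftarrow>p. lat e (f e))"

text \<open>
  In the following definition \<open>h\<close> is the decomposition of the arc flow \<open>f\<close> into flows along
  (vertex-simple, directed) \<open>s\<close>-\<open>t\<close> paths: \<open>h p\<close> is the flow carried by the path \<open>p\<close>.
\<close>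

definition user_equilibrium ::
  "('a, 'b) pre_digraph \<Rightarrow> ('b \<Rightarrow> real \<Rightarrow> real) \<Rightarrow> 'a \<Rightarrow> 'a \<Rightarrow> real \<Rightarrow> ('b \<Rightarrow> real) \<Rightarrow> bool" where
  "user_equilibrium G lat s t q f \<longleftrightarrow>
     feasible_flow G s t q f \<and>
     (\<exists>h :: 'b awalk \<Rightarrow> real.
        (\<forall>p. pre_digraph.apath G s p t \<longrightarrow> h p \<ge> 0) \<and>
        (\<forall>e\<in>arcs G. f e = (\<Sum>p | pre_digraph.apath G s p t \<and> e \<in> set p. h p)) \<and>
        (\<forall>p p'. pre_digraph.apath G s p t \<and> pre_digraph.apath G s p' t \<and> h p > 0 \<longrightarrow>
           path_latency lat f p \<le> path_latency lat f p'))"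

definition equilibrium_cost ::
  "('a, 'b) pre_digraph \<Rightarrow> ('b \<Rightarrow> real \<Rightarrow> real) \<Rightarrow> 'a \<Rightarrow> 'a \<Rightarrow> real \<Rightarrow> real" where
  "equilibrium_cost G lat s t q =
     (THE C. \<exists>f. user_equilibrium G lat s t q f \<and> C = flow_cost G lat f)"

section \<open>The directed grid and chords\<close>

type_synonym vertex = "nat \<times> nat"

definition grid :: "nat \<Rightarrow> nat \<Rightarrow> (vertex, vertex \<times> vertex) pre_digraph" where
  "grid m n =
     \<lparr> verts = {0..m} \<times> {0..n},
       arcs = {((i, j), (i + 1, j)) | i j. i < m \<and> j \<le> n} \<union>
              {((i, j), (i, j + 1)) | i j. i \<le> m \<and> j < n},
       tail = fst, head = snd \<rparr>"

definition grid_adjacent :: "nat \<Rightarrow> nat \<Rightarrow> vertex \<Rightarrow> vertex \<Rightarrow> bool" where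
  "grid_adjacent m n x y \<longleftrightarrow> (x, y) \<in> arcs (grid m n) \<or> (y, x) \<in> arcs (grid m n)"

definition is_chord :: "nat \<Rightarrow> nat \<Rightarrow> vertex \<Rightarrow> vertex \<Rightarrow> bool" where
  "is_chord m n u v \<longleftrightarrow>
     u \<in> verts (grid m n) \<and> v \<in> verts (grid m n) \<and> u \<noteq> v \<and> \<not> grid_adjacent m n u v"

definition level :: "vertex \<Rightarrow> nat" where
  "level w = fst w + snd w"

definition level_gain :: "vertex \<Rightarrow> vertex \<Rightarrow> int" where
  "level_gain u v = int (level v) - int (level u)"

definition grid_with_chord ::
  "nat \<Rightarrow> nat \<Rightarrow> vertex \<Rightarrow> vertex \<Rightarrow> (vertex, vertex \<times> vertex) pre_digraph" where
  "grid_with_chord m n u v = pre_digraph.add_arc (grid m n) (u, v)"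

section \<open>Braess ratio\<close>

definition grid_latency :: "real \<Rightarrow> real \<Rightarrow> vertex \<times> vertex \<Rightarrow> real \<Rightarrow> real" where
  "grid_latency a b e x = a * x + b"

definition chord_latency ::
  "real \<Rightarrow> real \<Rightarrow> real \<Rightarrow> real \<Rightarrow> vertex \<Rightarrow> vertex \<Rightarrow> vertex \<times> vertex \<Rightarrow> real \<Rightarrow> real" where
  "chord_latency a b c d u v e x = (if e = (u, v) then c * x + d else a * x + b)"

definition braess_ratio ::
  "nat \<Rightarrow> nat \<Rightarrow> real \<Rightarrow> real \<Rightarrow> real \<Rightarrow> real \<Rightarrow> real \<Rightarrow> vertex \<Rightarrow> vertex \<Rightarrow> real" where
  "braess_ratio m n q a b c d u v =
     equilibrium_cost (grid_with_chord m n u v) (chord_latency a b c d u v) (0, 0) (m, n) q /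
     equilibrium_cost (grid m n) (grid_latency a b) (0, 0) (m, n) q"

definition braess_capable ::
  "nat \<Rightarrow> nat \<Rightarrow> real \<Rightarrow> real \<Rightarrow> vertex \<Rightarrow> vertex \<Rightarrow> bool" where
  "braess_capable m n a q u v \<longleftrightarrow>
     (\<exists>b c d. b \<ge> 0 \<and> c \<ge> 0 \<and> d \<ge> 0 \<and> braess_ratio m n q a b c d u v > 1)"

section \<open>Electrical quantities\<close>

text \<open>The Moore--Penrose pseudoinverse of a real matrix, given by the four Penrose conditions.\<close>

definition is_pseudoinverse :: "real mat \<Rightarrow> real mat \<Rightarrow> bool" where
  "is_pseudoinverse A X \<longleftrightarrow>
     X \<in> carrier_mat (dim_col A) (dim_row A) \<and>
     A * X * A = A \<and> X * A * X = X \<and>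
     transpose_mat (A * X) = A * X \<and> transpose_mat (X * A) = X * A"

definition pseudoinverse :: "real mat \<Rightarrow> real mat" where
  "pseudoinverse A = (THE X. is_pseudoinverse A X)"

text \<open>
  Vectors and matrices over the vertex set \<open>{0..m} \<times> {0..n}\<close> are indexed by
  \<open>0, \<dots>, (m + 1) * (n + 1) - 1\<close>, enumerating the vertices lexicographically.
\<close>

definition vertex_index :: "nat \<Rightarrow> vertex \<Rightarrow> nat" where
  "vertex_index n w = fst w * (n + 1) + snd w"

definition index_vertex :: "nat \<Rightarrow> nat \<Rightarrow> vertex" where
  "index_vertex n k = (k div (n + 1), k mod (n + 1))"

definition grid_size :: "nat \<Rightarrow> nat \<Rightarrow> nat" where
  "grid_size m n = (m + 1) * (n + 1)"

definition grid_degree :: "nat \<Rightarrow> nat \<Rightarrow> vertex \<Rightarrow> nat" where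
  "grid_degree m n x = card {y. grid_adjacent m n x y}"

definition grid_laplacian :: "nat \<Rightarrow> nat \<Rightarrow> real \<Rightarrow> real mat" where
  "grid_laplacian m n a =
     mat (grid_size m n) (grid_size m n)
       (\<lambda>(k, l). let x = index_vertex n k; y = index_vertex n l in
          if x = y then real (grid_degree m n x) / a
          else if grid_adjacent m n x y then - 1 / a
          else 0)"

definition vertex_unit :: "nat \<Rightarrow> nat \<Rightarrow> vertex \<Rightarrow> real vec" where
  "vertex_unit m n w = unit_vec (grid_size m n) (vertex_index n w)"

definition chord_voltage ::
  "nat \<Rightarrow> nat \<Rightarrow> real \<Rightarrow> real \<Rightarrow> vertex \<Rightarrow> vertex \<Rightarrow> real" where
  "chord_voltage m n a q u v =
     q * scalar_prod (vertex_unit m n (0, 0) - vertex_unit m n (m, n))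
           (pseudoinverse (grid_laplacian m n a) *\<^sub>v (vertex_unit m n u - vertex_unit m n v))"

end

theory Submission
  imports Defs "HOL-Analysis.Function_Topology" "Jordan_Normal_Form.Determinant"
begin

text \<open>
  All directed \<open>s\<close>-\<open>t\<close> paths of the grid have the same number of arcs, so its equilibrium is the
  electrical flow \<open>g\<close>, which is positive on every arc by a minimum principle. Let \<open>f\<close> be the
  equilibrium with the chord, \<open>y\<close> the chord flow, and \<open>V\<close>, \<open>k\<close> the voltage and the level gain of the
  chord. Testing the variational inequality of \<open>f\<close> against \<open>g\<close> gives, by reciprocity,
  \<open>C_new \<le> C_old - y V\<close>; no case distinction on the support of \<open>f\<close> is needed. Expanding
  \<open>0 \<le> \<Sum> a (f - g)\<^sup>2\<close> over the grid arcs gives \<open>y (c y + d) \<le> y (V + b k)\<close>. Hence a cost increase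
  forces \<open>y > 0\<close>, \<open>V < 0\<close> and then \<open>k > 0\<close>. Conversely, if \<open>V < 0 < k\<close>, superimposing a small
  chord flow \<open>y\<close> on \<open>g\<close> yields a potential flow; it is an equilibrium for a suitable constant chord
  latency, which is nonnegative for large \<open>b\<close>, and its cost is \<open>C_old - y V\<close>.
\<close>

section \<open>Equilibria in networks with affine latencies\<close>

context fin_digraph
begin

text \<open>Summation by parts: an arc meets \<pi> at its tail as outflow and at its head as inflow,
  so the arcs are regrouped by their end vertices. Taking indicators, levels or voltages for \<pi>
  gives the later flow identities.\<close>

lemma sum_potential_drop:
  fixes f :: "'b \<Rightarrow> real" and \<pi> :: "'a \<Rightarrow> real"
  shows "(\<Sum>e\<in>arcs G. f e * (\<pi> (tail G e) - \<pi> (head G e))) =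
    (\<Sum>w\<in>verts G. \<pi> w * net_outflow G f w)"
proof -
  have group: "(\<Sum>w\<in>verts G. \<pi> w * (\<Sum>e\<in>{e \<in> arcs G. k e = w}. f e)) =
      (\<Sum>e\<in>arcs G. f e * \<pi> (k e))" if "k ` arcs G \<subseteq> verts G" for k
  proof -
    have "(\<Sum>w\<in>verts G. \<pi> w * (\<Sum>e\<in>{e \<in> arcs G. k e = w}. f e)) =
        (\<Sum>w\<in>verts G. \<Sum>e\<in>{e \<in> arcs G. k e = w}. f e * \<pi> (k e))"
      by (rule sum.cong) (auto simp: sum_distrib_left mult.commute intro!: sum.cong)
    also have "\<dots> = (\<Sum>e\<in>arcs G. f e * \<pi> (k e))"
      by (rule sum.group) (use that in auto)
    finally show ?thesis .
  qed
  have "(\<Sum>w\<in>verts G. \<pi> w * net_outflow G f w) =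
      (\<Sum>w\<in>verts G. \<pi> w * (\<Sum>e\<in>{e \<in> arcs G. tail G e = w}. f e)) -
      (\<Sum>w\<in>verts G. \<pi> w * (\<Sum>e\<in>{e \<in> arcs G. head G e = w}. f e))"
    by (simp add: net_outflow_def out_arcs_def in_arcs_def right_diff_distrib sum_subtractf)
  also have "\<dots> = (\<Sum>e\<in>arcs G. f e * \<pi> (tail G e)) - (\<Sum>e\<in>arcs G. f e * \<pi> (head G e))"
    by (subst (1 2) group) auto
  finally show ?thesis
    by (simp add: right_diff_distrib sum_subtractf)
qed

text \<open>The potential drop of the indicator of \<open>w\<close>. A single sum over all arcs
  results, to which \<open>sum_path_flow\<close> applies.\<close>

lemma net_outflow_eq_sum_arcs:
  assumes "w \<in> verts G"
  shows "net_outflow G f w =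
    (\<Sum>e\<in>arcs G. f e * (of_bool (tail G e = w) - of_bool (head G e = w)))"
proof -
  have "(\<Sum>e\<in>arcs G. f e * (of_bool (tail G e = w) - of_bool (head G e = w))) =
      (\<Sum>x\<in>verts G. of_bool (x = w) * net_outflow G f x)"
    by (rule sum_potential_drop)
  also have "\<dots> = (\<Sum>x\<in>verts G. if x = w then net_outflow G f x else 0)"
    by (intro sum.cong) auto
  finally show ?thesis
    using assms by simp
qed

text \<open>Conservation leaves only the terms at \<open>s\<close> and \<open>t\<close>, so the
  value is the same for every feasible flow.\<close>

lemma feasible_flow_potential_drop:
  assumes "feasible_flow G s t q f" "s \<in> verts G" "t \<in> verts G" "s \<noteq> t"
  shows "(\<Sum>e\<in>arcs G. f e * (\<pi> (tail G e) - \<pi> (head G e))) = q * (\<pi> s - \<pi> t)"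
proof -
  have "(\<Sum>w\<in>verts G. \<pi> w * net_outflow G f w) = (\<Sum>w\<in>{s, t}. \<pi> w * net_outflow G f w)"
    using assms by (intro sum.mono_neutral_right) (auto simp: feasible_flow_def)
  also have "\<dots> = q * (\<pi> s - \<pi> t)"
  proof -
    have "net_outflow G f s = q" "net_outflow G f t = - q"
      using assms by (auto simp: feasible_flow_def)
    with assms show ?thesis by (simp add: algebra_simps)
  qed
  finally show ?thesis
    by (simp add: sum_potential_drop)
qed

lemma awalk_potential_drop:
  fixes \<pi> :: "'a \<Rightarrow> real"
  assumes "awalk x p y"
  shows "(\<Sum>e\<leftarrow>p. \<pi> (tail G e) - \<pi> (head G e)) = \<pi> x - \<pi> y"
  using assms by (induction p arbitrary: x) (auto simp: awalk_Nil_iff awalk_Cons_iff)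

definition path_flow :: "'a \<Rightarrow> 'a \<Rightarrow> ('b awalk \<Rightarrow> real) \<Rightarrow> 'b \<Rightarrow> real" where
  "path_flow s t h e = (\<Sum>p | apath s p t \<and> e \<in> set p. h p)"

lemma sum_path_flow:
  "(\<Sum>e\<in>arcs G. path_flow s t h e * c e) = (\<Sum>p | apath s p t. h p * (\<Sum>e\<leftarrow>p. c e))"
proof -
  let ?P = "{p. apath s p t}"
  have fin: "finite ?P"
    by (rule apaths_finite)
  have "path_flow s t h e = (\<Sum>p\<in>?P. if e \<in> set p then h p else 0)" for e
    unfolding path_flow_def using fin
    by (subst sum.inter_filter[symmetric]) (auto intro: sum.cong)
  then have "(\<Sum>e\<in>arcs G. path_flow s t h e * c e) =
      (\<Sum>e\<in>arcs G. \<Sum>p\<in>?P. if e \<in> set p then h p * c e else 0)"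
    by (simp add: sum_distrib_right if_distrib cong: if_cong) (auto intro!: sum.cong)
  also have "\<dots> = (\<Sum>p\<in>?P. \<Sum>e\<in>arcs G. if e \<in> set p then h p * c e else 0)"
    by (rule sum.swap)
  also have "\<dots> = (\<Sum>p\<in>?P. h p * (\<Sum>e\<leftarrow>p. c e))"
  proof (intro sum.cong refl)
    fix p assume "p \<in> ?P"
    \<comment> \<open>A vertex-simple path repeats no arc, so sums over \<open>set p\<close> and
      over the list \<open>p\<close> agree.\<close>
    then have p: "awalk s p t" "distinct p" "set p \<subseteq> arcs G"
      by (auto simp: apath_def intro: distinct_verts_imp_distinct)
    have "(\<Sum>e\<in>arcs G. if e \<in> set p then h p * c e else 0) = (\<Sum>e\<in>set p. h p * c e)"
      using p(3) by (subst sum.inter_filter[symmetric]) (auto intro!: sum.cong)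
    also have "\<dots> = h p * (\<Sum>e\<leftarrow>p. c e)"
      using p(2) by (simp add: sum_distrib_left sum_list_distinct_conv_sum_set)
    finally show "(\<Sum>e\<in>arcs G. if e \<in> set p then h p * c e else 0) = h p * (\<Sum>e\<leftarrow>p. c e)" .
  qed
  finally show ?thesis .
qed

text \<open>Along one path the indicator of \<open>w\<close> telescopes to its values at the two
  ends.\<close>

lemma path_flow_net_outflow:
  assumes "w \<in> verts G"
  shows "net_outflow G (path_flow s t h) w =
    (\<Sum>p | apath s p t. h p) * (of_bool (s = w) - of_bool (t = w))"
proof -
  have "net_outflow G (path_flow s t h) w =
      (\<Sum>p | apath s p t. h p * (\<Sum>e\<leftarrow>p. of_bool (tail G e = w) - of_bool (head G e = w)))"
    using assms by (simp add: net_outflow_eq_sum_arcs sum_path_flow)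
  also have "\<dots> = (\<Sum>p | apath s p t. h p * (of_bool (s = w) - of_bool (t = w)))"
    by (intro sum.cong refl arg_cong2[of _ _ _ _ "(*)"]
        awalk_potential_drop[where \<pi> = "\<lambda>x. of_bool (x = w)"])
      (auto simp: apath_def)
  finally show ?thesis
    by (simp add: sum_distrib_right)
qed

lemma net_outflow_cong:
  "(\<And>e. e \<in> arcs G \<Longrightarrow> f e = g e) \<Longrightarrow> net_outflow G f w = net_outflow G g w"
  by (simp add: net_outflow_def out_arcs_def in_arcs_def)

end

section \<open>Affine latencies: duality, the variational inequality and existence of
  equilibria\<close>

locale affine_network = fin_digraph G for G :: "('a, 'b) pre_digraph" (structure) +
  fixes s t :: 'a and q :: real and \<alpha> \<beta> :: "'b \<Rightarrow> real"
  assumes source: "s \<in> verts G" and sink: "t \<in> verts G" and source_ne_sink: "s \<noteq> t"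
    and sink_reachable: "s \<rightarrow>\<^sup>* t"
    and demand_pos: "q > 0"
    and slope_nonneg: "e \<in> arcs G \<Longrightarrow> \<alpha> e \<ge> 0"
    and const_nonneg: "e \<in> arcs G \<Longrightarrow> \<beta> e \<ge> 0"
begin

definition latency :: "'b \<Rightarrow> real \<Rightarrow> real" where
  "latency e x = \<alpha> e * x + \<beta> e"

abbreviation paths :: "'b awalk set" where
  "paths \<equiv> {p. apath s p t}"

lemma paths_nonempty: "paths \<noteq> {}"
  using sink_reachable by (auto simp: reachable_awalk intro: apath_awalk_to_apath)

definition min_latency :: "('b \<Rightarrow> real) \<Rightarrow> real" where
  "min_latency c = (MIN p\<in>paths. \<Sum>e\<leftarrow>p. c e)"

text \<open>Cutting out a cycle cannot raise a nonnegative cost, and repeated cutting ends in a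
  path. Walks matter because the dual potential below is an infimum over them: unlike a path, a walk
  can be extended by any arc at its end.\<close>

lemma min_latency_le_awalk:
  assumes c: "\<And>e. e \<in> arcs G \<Longrightarrow> c e \<ge> 0" and p: "awalk s p t"
  shows "min_latency c \<le> (\<Sum>e\<leftarrow>p. c e)"
  using p
proof (induction rule: awalk_to_apath_induct)
  case (path p)
  then show ?case
    unfolding min_latency_def
    by (intro Min_le finite_imageI apaths_finite) (auto simp: apath_def)
next
  case (decomp p q r r')
  then have "p = q @ r @ r'" "awalk s p t" "min_latency c \<le> (\<Sum>e\<leftarrow>q @ r'. c e)"
    by (auto dest: awalk_cyc_decomp_has_prop)
  moreover from this have "(\<Sum>e\<leftarrow>r. c e) \<ge> 0"
    by (intro sum_list_nonneg) (auto intro!: c simp: awalk_def)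
  ultimately show ?case
    by simp
qed

text \<open>
  Linear programming duality: the distance from \<open>s\<close>, truncated at the minimal latency so that it
  is finite on vertices unreachable from \<open>s\<close>, is a feasible dual potential.
\<close>

lemma min_latency_le_flow:
  assumes c: "\<And>e. e \<in> arcs G \<Longrightarrow> c e \<ge> 0" and g: "feasible_flow G s t q g"
  shows "q * min_latency c \<le> (\<Sum>e\<in>arcs G. g e * c e)"
proof -
  let ?M = "min_latency c"
  \<comment> \<open>Inserting \<open>?M\<close> makes every set nonempty and truncates \<delta> at
    \<open>?M\<close>.\<close>
  define D where "D w = insert ?M {\<Sum>e\<leftarrow>p. c e | p. awalk s p w}" for w
  define \<delta> where "\<delta> w = Inf (D w)" for w
  have walk_nonneg: "(\<Sum>e\<leftarrow>p. c e) \<ge> 0" if "awalk s p w" for p w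
    using that by (intro sum_list_nonneg) (auto intro!: c simp: awalk_def)
  have "?M \<in> (\<lambda>p. \<Sum>e\<leftarrow>p. c e) ` paths"
    unfolding min_latency_def by (rule Min_in) (use paths_nonempty apaths_finite in auto)
  then have M: "?M \<ge> 0"
    by (auto simp: apath_def dest: walk_nonneg)
  have bdd: "bdd_below (D w)" for w
    by (rule bdd_belowI[of _ 0]) (use M walk_nonneg in \<open>auto simp: D_def\<close>)
  have lip: "\<delta> (head G e) - \<delta> (tail G e) \<le> c e" if e: "e \<in> arcs G" for e
  proof -
    have "\<delta> (head G e) - c e \<le> \<delta> (tail G e)"
      unfolding \<delta>_def[of "tail G e"]
    proof (rule cInf_greatest)
      show "D (tail G e) \<noteq> {}"
        by (simp add: D_def)
      fix z assume "z \<in> D (tail G e)"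
      then consider "z = ?M" | p where "awalk s p (tail G e)" "z = (\<Sum>e\<leftarrow>p. c e)"
        by (auto simp: D_def)
      then show "\<delta> (head G e) - c e \<le> z"
      proof cases
        case 1
        have "\<delta> (head G e) \<le> ?M"
          unfolding \<delta>_def by (rule cInf_lower[OF _ bdd]) (simp add: D_def)
        with 1 c[OF e] show ?thesis by simp
      next
        case 2
        have "awalk s (p @ [e]) (head G e)"
          using 2(1) arc_implies_awalk[OF e] by (rule awalk_appendI)
        then have "(\<Sum>e\<leftarrow>p @ [e]. c e) \<in> D (head G e)"
          unfolding D_def by blast
        then have "\<delta> (head G e) \<le> (\<Sum>e\<leftarrow>p @ [e]. c e)"
          unfolding \<delta>_def by (rule cInf_lower[OF _ bdd])
        with 2 show ?thesis by simp
      qed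
    qed
    then show ?thesis by simp
  qed
  have "\<delta> s \<le> 0"
    unfolding \<delta>_def
    by (rule cInf_lower[OF _ bdd]) (auto simp: D_def awalk_Nil_iff source intro!: exI[of _ "[]"])
  moreover have "?M \<le> \<delta> t"
    unfolding \<delta>_def
    by (rule cInf_greatest) (auto simp: D_def intro!: min_latency_le_awalk c)
  ultimately have "q * ?M \<le> q * (\<delta> t - \<delta> s)"
    using demand_pos by (intro mult_left_mono) auto
  also have "\<dots> = (\<Sum>e\<in>arcs G. g e * (\<delta> (head G e) - \<delta> (tail G e)))"
    using feasible_flow_potential_drop[OF g source sink source_ne_sink, of "\<lambda>w. - \<delta> w"]
    by (simp add: algebra_simps)
  also have "\<dots> \<le> (\<Sum>e\<in>arcs G. g e * c e)"
    using g lip by (intro sum_mono mult_left_mono) (auto simp: feasible_flow_def)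
  finally show ?thesis .
qed

text \<open>The variational form of the equilibrium condition. It mentions no paths, so a flow given
  by a potential can be checked directly and an equilibrium can be tested against any explicit
  flow.\<close>

definition variational_equilibrium :: "('b \<Rightarrow> real) \<Rightarrow> bool" where
  "variational_equilibrium f \<longleftrightarrow> feasible_flow G s t q f \<and>
     (\<forall>g. feasible_flow G s t q g \<longrightarrow> flow_cost G latency f \<le> (\<Sum>e\<in>arcs G. g e * latency e (f e)))"

text \<open>Used paths have minimal latency, so \<open>f\<close> costs at most \<open>q\<close>
  times that minimum; by duality no feasible flow costs less at the latencies frozen at
  \<open>f\<close>.\<close>

lemma user_equilibrium_imp_variational:
  assumes "user_equilibrium G latency s t q f"
  shows "variational_equilibrium f"
proof -
  from assms obtain h where f: "feasible_flow G s t q f"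
    and h: "\<And>p. apath s p t \<Longrightarrow> h p \<ge> 0"
    and fh: "\<And>e. e \<in> arcs G \<Longrightarrow> f e = path_flow s t h e"
    and opt: "\<And>p p'. apath s p t \<Longrightarrow> apath s p' t \<Longrightarrow> h p > 0 \<Longrightarrow>
      path_latency latency f p \<le> path_latency latency f p'"
    unfolding user_equilibrium_def path_flow_def by blast
  define c where "c e = latency e (f e)" for e
  have c: "c e \<ge> 0" if "e \<in> arcs G" for e
    using that f slope_nonneg const_nonneg by (auto simp: c_def latency_def feasible_flow_def)
  have lat: "path_latency latency f p = (\<Sum>e\<leftarrow>p. c e)" for p
    by (simp add: path_latency_def c_def)
  have total: "(\<Sum>p\<in>paths. h p) = q"
  proof -
    have "q = net_outflow G (path_flow s t h) s"
      using f fh by (subst net_outflow_cong[of _ f]) (auto simp: feasible_flow_def)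
    then show ?thesis
      using source source_ne_sink by (simp add: path_flow_net_outflow)
  qed
  have "flow_cost G latency f = (\<Sum>e\<in>arcs G. path_flow s t h e * c e)"
    unfolding flow_cost_def c_def using fh by (intro sum.cong) auto
  also have "\<dots> = (\<Sum>p\<in>paths. h p * (\<Sum>e\<leftarrow>p. c e))"
    by (rule sum_path_flow)
  also have "\<dots> \<le> (\<Sum>p\<in>paths. h p * min_latency c)"
  proof (rule sum_mono)
    fix p assume p: "p \<in> paths"
    show "h p * (\<Sum>e\<leftarrow>p. c e) \<le> h p * min_latency c"
    proof (cases "h p > 0")
      case True
      have "(\<Sum>e\<leftarrow>p. c e) \<le> min_latency c"
        unfolding min_latency_def
        using p paths_nonempty apaths_finite opt True by (subst Min_ge_iff) (auto simp: lat)
      with True show ?thesis by simp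
    next
      case False
      with h[of p] p show ?thesis by simp
    qed
  qed
  also have "\<dots> = q * min_latency c"
    by (simp add: total flip: sum_distrib_right)
  finally have "flow_cost G latency f \<le> q * min_latency c" .
  then show ?thesis
    using f min_latency_le_flow[of c] c unfolding variational_equilibrium_def c_def
    by (blast intro: order_trans)
qed

text \<open>Each inequality is tested against the other flow and the two are added: a sum of squares
  with weights \<alpha> is at most 0, so each term vanishes. Where \<alpha> is 0 the latency is
  constant anyway.\<close>

lemma variational_equilibria_same_latency:
  assumes "variational_equilibrium f" "variational_equilibrium g" "e \<in> arcs G"
  shows "latency e (f e) = latency e (g e)"
proof -
  have "(\<Sum>e\<in>arcs G. \<alpha> e * (f e - g e)\<^sup>2) =
      flow_cost G latency f - (\<Sum>e\<in>arcs G. g e * latency e (f e)) +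
      (flow_cost G latency g - (\<Sum>e\<in>arcs G. f e * latency e (g e)))"
    unfolding flow_cost_def latency_def
    by (simp add: power2_eq_square algebra_simps flip: sum.distrib sum_subtractf)
  also have "\<dots> \<le> 0"
    using assms(1,2) by (fastforce simp: variational_equilibrium_def)
  finally have "(\<Sum>e\<in>arcs G. \<alpha> e * (f e - g e)\<^sup>2) = 0"
    by (intro antisym sum_nonneg) (auto simp: slope_nonneg)
  then have "\<alpha> e * (f e - g e)\<^sup>2 = 0"
    using assms(3) by (subst (asm) sum_nonneg_eq_0_iff) (auto simp: slope_nonneg)
  then show ?thesis
    by (auto simp: latency_def)
qed

text \<open>Arcs of slope 0, such as a chord of constant latency, are allowed, so uniqueness is
  shown for the cost rather than for the flow. Equal latencies turn the mixed sum of the inequality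
  into the cost of the other flow.\<close>

lemma variational_equilibria_same_cost:
  assumes f: "variational_equilibrium f" and g: "variational_equilibrium g"
  shows "flow_cost G latency f = flow_cost G latency g"
proof -
  have *: "flow_cost G latency f' \<le> flow_cost G latency g'"
    if f': "variational_equilibrium f'" and g': "variational_equilibrium g'" for f' g'
  proof -
    have "flow_cost G latency f' \<le> (\<Sum>e\<in>arcs G. g' e * latency e (f' e))"
      using f' g' by (auto simp: variational_equilibrium_def)
    also have "\<dots> = flow_cost G latency g'"
      unfolding flow_cost_def
      using variational_equilibria_same_latency[OF f' g'] by (intro sum.cong) auto
    finally show ?thesis .
  qed
  from *[OF f g] *[OF g f] show ?thesis by simp
qed


text \<open>
  A minimiser of the Beckmann potential over the compact simplex of path flows is an equilibrium:
  diverting \<open>\<epsilon>\<close> units from a used path \<open>p\<close> to \<open>p'\<close> changes the potential by \<open>\<epsilon>\<close> times the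
  latency difference, up to \<open>O(\<epsilon>\<^sup>2)\<close>.
\<close>

lemma user_equilibrium_exists: "\<exists>f. user_equilibrium G latency s t q f"
proof -
  let ?F = "path_flow s t"
  define K where "K = {h :: 'b awalk \<Rightarrow> real. (\<forall>p\<in>paths. h p \<ge> 0) \<and> (\<forall>p. p \<notin> paths \<longrightarrow> h p = 0) \<and>
    (\<Sum>p\<in>paths. h p) = q}"
  define Z where "Z h = (\<Sum>e\<in>arcs G. \<alpha> e / 2 * (?F h e)\<^sup>2 + \<beta> e * ?F h e)" for h
  have fin: "finite paths"
    by (rule apaths_finite)
  have cont_sum: "continuous_on A (\<lambda>h :: 'b awalk \<Rightarrow> real. \<Sum>p\<in>P. h p)" for A P
    by (intro continuous_intros continuous_on_subset[OF continuous_on_product_coordinates]) auto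
  \<comment> \<open>Tychonoff: coordinates outside \<open>paths\<close> are pinned to 0, so
    \<open>B\<close> is a product of compact sets, and \<open>K\<close> is its intersection with a
    closed hyperplane.\<close>
  define B where "B = (PiE UNIV (\<lambda>p. if p \<in> paths then {0..q} else {0}) :: ('b awalk \<Rightarrow> real) set)"
  have "compactin (product_topology (\<lambda>p. euclidean) UNIV) B"
    unfolding B_def by (subst compactin_PiE) auto
  then have "compact B"
    by (simp add: euclidean_product_topology)
  moreover have "closed {h :: 'b awalk \<Rightarrow> real. (\<Sum>p\<in>paths. h p) = q}"
    by (intro closed_Collect_eq cont_sum continuous_intros)
  moreover have "K = B \<inter> {h. (\<Sum>p\<in>paths. h p) = q}"
  proof -
    have "h p \<le> q" if "\<forall>p\<in>paths. h p \<ge> 0" "(\<Sum>p\<in>paths. h p) = q" "p \<in> paths"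
      for h :: "'b awalk \<Rightarrow> real" and p
      using member_le_sum[of p paths h] that fin by auto
    then show ?thesis
      unfolding K_def B_def by (fastforce simp: PiE_def Pi_def split: if_splits)
  qed
  ultimately have "compact K"
    by (simp add: compact_Int_closed)
  moreover have "K \<noteq> {}"
  proof -
    obtain p0 where p0: "p0 \<in> paths"
      using paths_nonempty by blast
    have "(\<lambda>p. if p = p0 then q else 0) \<in> K"
      unfolding K_def using p0 fin demand_pos by auto
    then show ?thesis by blast
  qed
  moreover have "continuous_on K Z"
    unfolding Z_def path_flow_def by (intro continuous_intros cont_sum)
  ultimately obtain h where hK: "h \<in> K" and h_min: "\<And>h'. h' \<in> K \<Longrightarrow> Z h \<le> Z h'"
    using continuous_attains_inf[of K Z] by blast
  have opt: "path_latency latency (?F h) p \<le> path_latency latency (?F h) p'"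
    if p: "p \<in> paths" and p': "p' \<in> paths" and hp: "h p > 0" for p p'
  proof (cases "p = p'")
    case False
    define l where "l p = (\<Sum>e\<leftarrow>p. latency e (?F h e))" for p
    define D where "D r = of_bool (r = p') - (of_bool (r = p) :: real)" for r
    define A where "A = (\<Sum>e\<in>arcs G. \<alpha> e / 2 * (?F D e)\<^sup>2)"
    have "(\<Sum>e\<in>arcs G. ?F D e * latency e (?F h e)) = (\<Sum>r\<in>paths. D r * l r)"
      by (simp add: sum_path_flow l_def)
    also have "\<dots> = (\<Sum>r\<in>paths. if r = p' then l r else 0) - (\<Sum>r\<in>paths. if r = p then l r else 0)"
      by (auto simp: D_def simp flip: sum_subtractf intro!: sum.cong)
    finally have slope: "(\<Sum>e\<in>arcs G. ?F D e * latency e (?F h e)) = l p' - l p"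
      using p p' fin by simp
    \<comment> \<open>The bound \<open>h p\<close> keeps the shifted coordinate at \<open>p\<close>
      nonnegative.\<close>
    have shift: "0 \<le> (l p' - l p) + \<epsilon> * A" if \<epsilon>: "0 < \<epsilon>" "\<epsilon> \<le> h p" for \<epsilon>
    proof -
      have "(\<Sum>r\<in>paths. D r) = (\<Sum>r\<in>paths. if r = p' then 1 else 0) - (\<Sum>r\<in>paths. if r = p then 1 else 0)"
        by (auto simp: D_def simp flip: sum_subtractf intro!: sum.cong)
      then have "(\<Sum>r\<in>paths. D r) = 0"
        using p p' fin by simp
      then have "(\<lambda>r. h r + \<epsilon> * D r) \<in> K"
        using hK \<epsilon> p p' False
        by (auto simp: K_def D_def sum.distrib simp flip: sum_distrib_left)
      then have "Z h \<le> Z (\<lambda>r. h r + \<epsilon> * D r)"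
        by (rule h_min)
      also have "?F (\<lambda>r. h r + \<epsilon> * D r) e = ?F h e + \<epsilon> * ?F D e" for e
        by (simp add: path_flow_def sum.distrib sum_distrib_left)
      \<comment> \<open>The expansion is exact because the potential is quadratic; \<open>A\<close>
        is the second-order coefficient.\<close>
      then have "Z (\<lambda>r. h r + \<epsilon> * D r) =
          Z h + \<epsilon> * (\<Sum>e\<in>arcs G. ?F D e * latency e (?F h e)) + \<epsilon>\<^sup>2 * A"
        by (simp add: Z_def A_def latency_def power2_eq_square algebra_simps sum_distrib_left
            flip: sum.distrib)
      finally have "0 \<le> \<epsilon> * ((l p' - l p) + \<epsilon> * A)"
        by (simp add: slope power2_eq_square algebra_simps)
      then show ?thesis
        using \<epsilon> by (simp add: zero_le_mult_iff)
    qed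
    have "((\<lambda>\<epsilon>. (l p' - l p) + \<epsilon> * A) \<longlongrightarrow> (l p' - l p) + 0 * A) (at_right 0)"
      by (intro tendsto_intros)
    moreover have "\<forall>\<^sub>F \<epsilon> in at_right 0. 0 \<le> (l p' - l p) + \<epsilon> * A"
      using hp shift by (auto simp: eventually_at_right_field intro!: exI[of _ "h p"])
    ultimately have "0 \<le> (l p' - l p) + 0 * A"
      by (rule tendsto_lowerbound) auto
    then show ?thesis
      by (simp add: l_def path_latency_def)
  qed auto
  have "feasible_flow G s t q (?F h)"
    using hK source sink source_ne_sink
    by (auto simp: feasible_flow_def path_flow_net_outflow K_def path_flow_def intro!: sum_nonneg)
  then have "user_equilibrium G latency s t q (?F h)"
    unfolding user_equilibrium_def
    using hK opt by (auto simp: K_def path_flow_def intro!: exI[of _ h])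
  then show ?thesis by blast
qed

text \<open>Equilibria exist and share one cost, so the definite description is meaningful. The cost
  can thus be computed from a variational equilibrium, without exhibiting a path decomposition of
  it.\<close>

lemma equilibrium_cost_eqI:
  assumes "variational_equilibrium f"
  shows "equilibrium_cost G latency s t q = flow_cost G latency f"
  unfolding equilibrium_cost_def
proof (rule the_equality)
  obtain g where "user_equilibrium G latency s t q g"
    using user_equilibrium_exists by blast
  with assms show "\<exists>g. user_equilibrium G latency s t q g \<and> flow_cost G latency f = flow_cost G latency g"
    using user_equilibrium_imp_variational variational_equilibria_same_cost by blast
next
  fix C assume "\<exists>g. user_equilibrium G latency s t q g \<and> C = flow_cost G latency g"
  with assms show "C = flow_cost G latency f"
    using user_equilibrium_imp_variational variational_equilibria_same_cost by blast
qed

text \<open>If the latencies at \<open>f\<close> are potential drops, all feasible flows cost the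
  same at these latencies, so the variational inequality holds with equality.\<close>

lemma potential_flow_cost:
  assumes f: "feasible_flow G s t q f"
    and \<pi>: "\<And>e. e \<in> arcs G \<Longrightarrow> latency e (f e) = \<pi> (tail G e) - \<pi> (head G e)"
  shows "equilibrium_cost G latency s t q = q * (\<pi> s - \<pi> t)"
proof -
  have cost: "(\<Sum>e\<in>arcs G. g e * latency e (f e)) = q * (\<pi> s - \<pi> t)"
    if "feasible_flow G s t q g" for g
    using feasible_flow_potential_drop[OF that source sink source_ne_sink] \<pi> by simp
  then have "flow_cost G latency f = q * (\<pi> s - \<pi> t)"
    unfolding flow_cost_def using f by simp
  moreover have "variational_equilibrium f"
    unfolding variational_equilibrium_def using f cost calculation by simp
  ultimately show ?thesis
    using equilibrium_cost_eqI by simp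
qed

end

section \<open>Potentials on the grid\<close>

lemma mem_verts_grid [simp]: "(i, j) \<in> verts (grid m n) \<longleftrightarrow> i \<le> m \<and> j \<le> n"
  by (auto simp: grid_def)

lemma tail_grid [simp]: "tail (grid m n) = fst"
  and head_grid [simp]: "head (grid m n) = snd"
  by (simp_all add: grid_def)

lemma mem_arcs_grid:
  "((i, j), (k, l)) \<in> arcs (grid m n) \<longleftrightarrow>
     k = i + 1 \<and> l = j \<and> i < m \<and> j \<le> n \<or> k = i \<and> l = j + 1 \<and> i \<le> m \<and> j < n"
  by (auto simp: grid_def)

lemma fin_digraph_grid: "fin_digraph (grid m n)"
proof
  have "arcs (grid m n) \<subseteq> verts (grid m n) \<times> verts (grid m n)"
    by (auto simp: grid_def)
  then show "finite (arcs (grid m n))"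
    by (rule finite_subset) (simp add: grid_def)
qed (auto simp: grid_def)

text \<open>
  Truncated subtraction and \<open>min\<close> reflect the neighbours missing at the border back to the vertex
  itself, where they contribute \<open>0\<close>.
\<close>

definition stencil :: "nat \<Rightarrow> nat \<Rightarrow> (vertex \<Rightarrow> real) \<Rightarrow> vertex \<Rightarrow> real" where
  "stencil m n \<phi> = (\<lambda>(i, j). 4 * \<phi> (i, j) - \<phi> (i - 1, j) - \<phi> (min (i + 1) m, j)
     - \<phi> (i, j - 1) - \<phi> (i, min (j + 1) n))"

lemma out_arcs_grid:
  assumes "i \<le> m" "j \<le> n"
  shows "out_arcs (grid m n) (i, j) =
    (if i < m then {((i, j), (i + 1, j))} else {}) \<union> (if j < n then {((i, j), (i, j + 1))} else {})"
  using assms by (auto simp: out_arcs_def mem_arcs_grid)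

lemma in_arcs_grid:
  assumes "i \<le> m" "j \<le> n"
  shows "in_arcs (grid m n) (i, j) =
    (if 0 < i then {((i - 1, j), (i, j))} else {}) \<union> (if 0 < j then {((i, j - 1), (i, j))} else {})"
  using assms by (auto simp: in_arcs_def mem_arcs_grid)

text \<open>Identifies \<open>stencil\<close> as the grid Laplacian with unit resistances; the cases
  decide which of the four neighbours exist.\<close>

lemma net_outflow_grid:
  assumes "w \<in> verts (grid m n)"
  shows "net_outflow (grid m n) (\<lambda>e. \<phi> (fst e) - \<phi> (snd e)) w = stencil m n \<phi> w"
proof -
  obtain i j where "w = (i, j)" "i \<le> m" "j \<le> n"
    using assms by (cases w) auto
  then show ?thesis
    by (cases "i = 0"; cases "j = 0"; cases "i = m"; cases "j = n")
      (auto simp: net_outflow_def out_arcs_grid in_arcs_grid stencil_def min_def)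
qed

text \<open>Green's identity. Its left side is symmetric in \<phi> and \<pi>, which later yields
  reciprocity.\<close>

lemma grid_green:
  "(\<Sum>e\<in>arcs (grid m n). (\<phi> (fst e) - \<phi> (snd e)) * (\<pi> (fst e) - \<pi> (snd e))) =
     (\<Sum>w\<in>verts (grid m n). \<pi> w * stencil m n \<phi> w)"
  using fin_digraph.sum_potential_drop[OF fin_digraph_grid[of m n], of "\<lambda>e. \<phi> (fst e) - \<phi> (snd e)" \<pi>]
  by (simp add: net_outflow_grid)

text \<open>Testing with \<phi> itself shows that its Dirichlet energy vanishes, so \<phi> agrees
  across each arc; every vertex is reached through the vertices \<open>(i, 0)\<close> and then by
  raising the second coordinate.\<close>

lemma stencil_zero_imp_constant:
  assumes zero: "\<And>w. w \<in> verts (grid m n) \<Longrightarrow> stencil m n \<phi> w = 0"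
    and w: "w \<in> verts (grid m n)"
  shows "\<phi> w = \<phi> (0, 0)"
proof -
  interpret fin_digraph "grid m n"
    by (rule fin_digraph_grid)
  have "(\<Sum>e\<in>arcs (grid m n). (\<phi> (fst e) - \<phi> (snd e)) * (\<phi> (fst e) - \<phi> (snd e))) = 0"
    by (simp add: grid_green zero)
  then have arc: "\<phi> (fst e) = \<phi> (snd e)" if "e \<in> arcs (grid m n)" for e
    using that by (subst (asm) sum_nonneg_eq_0_iff) auto
  have row: "\<phi> (i, 0) = \<phi> (0, 0)" if "i \<le> m" for i
    using that
  proof (induction i)
    case (Suc i)
    with arc[of "((i, 0), (Suc i, 0))"] show ?case by (simp add: mem_arcs_grid)
  qed simp
  have "\<phi> (i, j) = \<phi> (0, 0)" if "i \<le> m" "j \<le> n" for i j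
    using that(2)
  proof (induction j)
    case 0
    show ?case using row[OF that(1)] .
  next
    case (Suc j)
    with that arc[of "((i, j), (i, Suc j))"] show ?case by (simp add: mem_arcs_grid)
  qed
  with w show ?thesis by (metis mem_verts_grid surj_pair)
qed

text \<open>
  The differences \<open>\<phi> i j - \<phi> (i + 1) j\<close> are superharmonic with zero boundary values beyond the
  first and last column, so the minimum principle applies to them.
\<close>

lemma stencil_strictly_decreasing:
  fixes \<phi> :: "nat \<Rightarrow> nat \<Rightarrow> real"
  assumes \<kappa>: "\<kappa> > 0"
    and eq: "\<And>i j. i \<le> m \<Longrightarrow> j \<le> n \<Longrightarrow>
      4 * \<phi> i j - \<phi> (i - 1) j - \<phi> (min (i + 1) m) j - \<phi> i (j - 1) - \<phi> i (min (j + 1) n) =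
      \<kappa> * (of_bool (i = 0 \<and> j = 0) - of_bool (i = m \<and> j = n))"
    and ij: "i < m" "j \<le> n"
  shows "\<phi> (i + 1) j < \<phi> i j"
proof (rule ccontr)
  assume neg: "\<not> \<phi> (i + 1) j < \<phi> i j"
  define \<psi> where "\<psi> i j = \<phi> i j - \<phi> (i + 1) j" for i j
  \<comment> \<open>\<open>A\<close> and \<open>B\<close> are the neighbouring values of \<psi> in
    the first coordinate, with 0 beyond the border, since reflection makes the difference across the
    border vanish.\<close>
  define A where "A i j = (if i = 0 then 0 else \<psi> (i - 1) j)" for i j
  define B where "B i j = (if i + 1 = m then 0 else \<psi> (i + 1) j)" for i j
  have super: "4 * \<psi> i j - A i j - B i j - \<psi> i (j - 1) - \<psi> i (min (j + 1) n)
      \<ge> \<kappa> * of_bool (i = 0 \<and> j = 0)" if "i < m" "j \<le> n" for i j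
  proof -
    \<comment> \<open>The equation at \<open>(i + 1, j)\<close> is subtracted from the one at
      \<open>(i, j)\<close>. This flips the sign of the sink term, so both sources on the right are
      nonnegative.\<close>
    have "4 * \<psi> i j - A i j - B i j - \<psi> i (j - 1) - \<psi> i (min (j + 1) n) =
        \<kappa> * (of_bool (i = 0 \<and> j = 0) + of_bool (i + 1 = m \<and> j = n))"
    proof -
      define r where "r = min (j + 1) n"
      define c where "c = \<kappa> * of_bool (i = 0 \<and> j = 0)"
      define d where "d = \<kappa> * of_bool (i + 1 = m \<and> j = n)"
      have A': "\<phi> (i - 1) j = \<phi> i j + A i j"
        by (cases i) (simp_all add: A_def \<psi>_def)
      have B': "\<phi> (min (i + 2) m) j = \<phi> (i + 1) j - B i j"
        using that by (simp add: B_def \<psi>_def min_def)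
      have "min (i + 1) m = i + 1" "i \<noteq> m" "i \<le> m"
        using that by simp_all
      then have eq1: "4 * \<phi> i j - (\<phi> i j + A i j) - \<phi> (i + 1) j - \<phi> i (j - 1) - \<phi> i r = c"
        using eq[of i j] that unfolding A' r_def c_def by simp
      have eq2: "4 * \<phi> (i + 1) j - \<phi> i j - (\<phi> (i + 1) j - B i j) - \<phi> (i + 1) (j - 1) -
          \<phi> (i + 1) r = - d"
        using eq[of "i + 1" j] that B' unfolding r_def d_def by simp
      show ?thesis
        using eq1 eq2 unfolding distrib_left \<psi>_def[of i]
        by (fold r_def c_def d_def) (simp add: algebra_simps)
    qed
    also have "\<dots> \<ge> \<kappa> * of_bool (i = 0 \<and> j = 0)"
      using \<kappa> by (intro mult_left_mono) auto
    finally show ?thesis .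
  qed
  let ?S = "{..<m} \<times> {..n}"
  define \<mu> where "\<mu> = Min ((\<lambda>(i, j). \<psi> i j) ` ?S)"
  have ne: "?S \<noteq> {}"
    using ij by auto
  have ge: "\<mu> \<le> \<psi> i j" if "i < m" "j \<le> n" for i j
    unfolding \<mu>_def using that by (intro Min_le) auto
  \<comment> \<open>By the assumed failure the minimum is nonpositive, so the zero boundary values
    in \<open>A\<close> and \<open>B\<close> also lie above it.\<close>
  have \<mu>: "\<mu> \<le> 0"
    using neg ge[OF ij] by (simp add: \<psi>_def)
  have A: "A i j \<ge> \<mu>" if "i < m" "j \<le> n" for i j
    using that \<mu> by (auto simp: A_def intro: ge)
  have B: "B i j \<ge> \<mu>" if "i < m" "j \<le> n" for i j
    using that \<mu> by (auto simp: B_def intro: ge)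
  \<comment> \<open>At a minimum point the four neighbours are at least \<mu> and sum to at most
    four times \<mu>, so all equal \<mu>; at \<open>(0, 0)\<close> the positive source term would
    make this impossible.\<close>
  have nbrs: "A i j = \<mu> \<and> \<psi> i (j - 1) = \<mu> \<and> \<not> (i = 0 \<and> j = 0)"
    if "i < m" "j \<le> n" "\<psi> i j = \<mu>" for i j
  proof -
    have "\<mu> \<le> \<psi> i (j - 1)" "\<mu> \<le> \<psi> i (min (j + 1) n)"
      using that by (intro ge; simp)+
    moreover have "0 \<le> \<kappa> * of_bool (i = 0 \<and> j = 0)"
      using \<kappa> by simp
    ultimately have "A i j = \<mu>" "\<psi> i (j - 1) = \<mu>" "\<kappa> * of_bool (i = 0 \<and> j = 0) = 0"
      using super[OF that(1,2)] A[OF that(1,2)] B[OF that(1,2)] that(3) by linarith+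
    then show ?thesis
      using \<kappa> by simp
  qed
  have "\<mu> \<in> (\<lambda>(i, j). \<psi> i j) ` ?S"
    unfolding \<mu>_def by (rule Min_in) (use ne in auto)
  then obtain k l where kl: "k < m" "l \<le> n" "\<psi> k l = \<mu>"
    by auto
  \<comment> \<open>The minimum is carried down to \<open>(0, l)\<close> and on to
    \<open>(0, 0)\<close>, where it is excluded.\<close>
  have "\<psi> 0 l = \<mu>"
    using kl(1,3)
  proof (induction k)
    case (Suc k)
    with nbrs[of "Suc k" l] kl(2) show ?case by (simp add: A_def)
  qed
  with kl(2) have "\<psi> 0 0 = \<mu>"
  proof (induction l)
    case (Suc l)
    with nbrs[of 0 "Suc l"] ij show ?case by simp
  qed
  with nbrs[of 0 0] ij show False by simp
qed

text \<open>Arcs in the second direction follow by exchanging the coordinates, under which the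
  equation keeps its form.\<close>

lemma stencil_strictly_decreasing_arc:
  assumes \<kappa>: "\<kappa> > 0"
    and eq: "\<And>w. w \<in> verts (grid m n) \<Longrightarrow>
      stencil m n \<phi> w = \<kappa> * (of_bool (w = (0, 0)) - of_bool (w = (m, n)))"
    and e: "e \<in> arcs (grid m n)"
  shows "\<phi> (snd e) < \<phi> (fst e)"
proof -
  have eq': "4 * \<phi> (i, j) - \<phi> (i - 1, j) - \<phi> (min (i + 1) m, j) - \<phi> (i, j - 1) - \<phi> (i, min (j + 1) n) =
      \<kappa> * (of_bool (i = 0 \<and> j = 0) - of_bool (i = m \<and> j = n))" if "i \<le> m" "j \<le> n" for i j
    using eq[of "(i, j)"] that by (simp add: stencil_def)
  have "\<phi> (i + 1, j) < \<phi> (i, j)" if "i < m" "j \<le> n" for i j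
    using stencil_strictly_decreasing[of \<kappa> m n "\<lambda>i j. \<phi> (i, j)"] \<kappa> eq' that by blast
  moreover have "\<phi> (i, j + 1) < \<phi> (i, j)" if "i \<le> m" "j < n" for i j
  proof (rule stencil_strictly_decreasing[of \<kappa> n m "\<lambda>j i. \<phi> (i, j)", OF \<kappa> _ that(2,1)])
    fix k l assume "k \<le> n" "l \<le> m"
    with eq'[of l k] show "4 * \<phi> (l, k) - \<phi> (l, k - 1) - \<phi> (l, min (k + 1) n) - \<phi> (l - 1, k) - \<phi> (min (l + 1) m, k) =
      \<kappa> * (of_bool (k = 0 \<and> l = 0) - of_bool (k = n \<and> l = m))"
      by (simp add: conj_commute)
  qed
  ultimately show ?thesis
    using e by (auto simp: grid_def)
qed

section \<open>Vertex numbering and the Laplacian as a matrix\<close>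

lemma vertex_index_less:
  assumes "w \<in> verts (grid m n)"
  shows "vertex_index n w < grid_size m n"
proof -
  obtain i j where w: "w = (i, j)" "i \<le> m" "j \<le> n"
    using assms by (cases w) auto
  then have "i * (n + 1) + j < i * (n + 1) + (n + 1)"
    by simp
  also have "\<dots> = (i + 1) * (n + 1)"
    by simp
  also have "\<dots> \<le> (m + 1) * (n + 1)"
    using w by (intro mult_right_mono) auto
  finally show ?thesis
    by (simp add: vertex_index_def grid_size_def w)
qed

lemma index_vertex_index:
  "w \<in> verts (grid m n) \<Longrightarrow> index_vertex n (vertex_index n w) = w"
  unfolding index_vertex_def vertex_index_def
  by (cases w) (simp del: add_Suc_right mult_Suc_right add: div_mult_self3)

lemma vertex_index_vertex: "vertex_index n (index_vertex n k) = k"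
  by (simp only: index_vertex_def vertex_index_def fst_conv snd_conv div_mult_mod_eq)

lemma index_vertex_in_verts:
  "k < grid_size m n \<Longrightarrow> index_vertex n k \<in> verts (grid m n)"
  by (simp add: index_vertex_def grid_size_def less_Suc_eq_le[symmetric] less_mult_imp_div_less)

lemma bij_betw_index_vertex:
  "bij_betw (index_vertex n) {0..<grid_size m n} (verts (grid m n))"
  by (rule bij_betw_byWitness[where f' = "vertex_index n"])
    (auto simp: vertex_index_vertex index_vertex_index index_vertex_in_verts
      intro: vertex_index_less simp del: mem_verts_grid split_paired_All)

lemma sum_index_vertex:
  "(\<Sum>k = 0..<grid_size m n. f (index_vertex n k)) = (\<Sum>w\<in>verts (grid m n). f w)"
  by (rule sum.reindex_bij_betw[OF bij_betw_index_vertex])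

lemma grid_neighbours:
  assumes "i \<le> m" "j \<le> n"
  shows "{y. grid_adjacent m n (i, j) y} =
    (if i < m then {(i + 1, j)} else {}) \<union> (if j < n then {(i, j + 1)} else {}) \<union>
    (if 0 < i then {(i - 1, j)} else {}) \<union> (if 0 < j then {(i, j - 1)} else {})"
  using assms by (auto simp: grid_adjacent_def mem_arcs_grid)

lemma sum_grid_neighbours:
  assumes "w \<in> verts (grid m n)"
  shows "real (grid_degree m n w) * \<phi> w - (\<Sum>y | grid_adjacent m n w y. \<phi> y) = stencil m n \<phi> w"
proof -
  obtain i j where "w = (i, j)" "i \<le> m" "j \<le> n"
    using assms by (cases w) auto
  then show ?thesis
    by (cases "i = 0"; cases "j = 0"; cases "i = m"; cases "j = n")
      (auto simp: grid_degree_def grid_neighbours stencil_def min_def)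
qed

definition vec_potential :: "nat \<Rightarrow> real vec \<Rightarrow> vertex \<Rightarrow> real" where
  "vec_potential n x w = x $ vertex_index n w"

lemma grid_laplacian_carrier [simp]:
  "grid_laplacian m n a \<in> carrier_mat (grid_size m n) (grid_size m n)"
  by (simp add: grid_laplacian_def)

text \<open>The bridge from matrices to potentials: a row of the Laplacian is regrouped over
  vertices into a degree term and a sum over neighbours.\<close>

lemma grid_laplacian_mult_vec:
  assumes x: "x \<in> carrier_vec (grid_size m n)" and k: "k < grid_size m n"
  shows "(grid_laplacian m n a *\<^sub>v x) $ k = stencil m n (vec_potential n x) (index_vertex n k) / a"
proof -
  let ?w = "index_vertex n k" and ?\<phi> = "vec_potential n x"
  have w: "?w \<in> verts (grid m n)"
    using k by (rule index_vertex_in_verts)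
  have fin: "finite (verts (grid m n))"
    by (simp add: grid_def)
  have sub: "{y. grid_adjacent m n ?w y} \<subseteq> verts (grid m n)"
    by (auto simp: grid_adjacent_def grid_def)
  have irr: "\<not> grid_adjacent m n y y" for y
    by (cases y) (auto simp: grid_adjacent_def mem_arcs_grid)
  define l where "l y = (if ?w = y then real (grid_degree m n ?w) / a
          else if grid_adjacent m n ?w y then - 1 / a else 0)" for y
  have entry: "grid_laplacian m n a $$ (k, i) = l (index_vertex n i)" if "i < grid_size m n" for i
    using that k by (simp add: grid_laplacian_def l_def Let_def)
  have "(grid_laplacian m n a *\<^sub>v x) $ k =
      (\<Sum>i = 0..<grid_size m n. grid_laplacian m n a $$ (k, i) * x $ i)"
    using x k carrier_matD[OF grid_laplacian_carrier[of m n a]]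
    by (simp add: scalar_prod_def del: grid_laplacian_carrier)
  also have "\<dots> = (\<Sum>i = 0..<grid_size m n. l (index_vertex n i) * ?\<phi> (index_vertex n i))"
    by (intro sum.cong) (simp_all add: entry vec_potential_def vertex_index_vertex)
  also have "\<dots> = (\<Sum>y\<in>verts (grid m n). l y * ?\<phi> y)"
    by (rule sum_index_vertex)
  also have "\<dots> = (\<Sum>y\<in>verts (grid m n).
      (if y = ?w then real (grid_degree m n ?w) / a * ?\<phi> y else 0) -
      (if y \<in> {y. grid_adjacent m n ?w y} then ?\<phi> y / a else 0))"
    using irr by (intro sum.cong) (auto simp: l_def)
  also have "\<dots> = real (grid_degree m n ?w) / a * ?\<phi> ?w - (\<Sum>y | grid_adjacent m n ?w y. ?\<phi> y / a)"
  proof -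
    have "(\<Sum>y\<in>verts (grid m n). if y \<in> {y. grid_adjacent m n ?w y} then ?\<phi> y / a else 0) =
        (\<Sum>y | grid_adjacent m n ?w y. ?\<phi> y / a)"
      using sub fin by (subst sum.inter_restrict[symmetric]) (auto simp: Int_absorb1)
    then show ?thesis
      using w fin by (simp only: sum_subtractf) simp
  qed
  also have "\<dots> = (real (grid_degree m n ?w) * ?\<phi> ?w - (\<Sum>y | grid_adjacent m n ?w y. ?\<phi> y)) / a"
    by (simp add: diff_divide_distrib flip: sum_divide_distrib)
  finally show ?thesis
    by (simp only: sum_grid_neighbours[OF w])
qed

section \<open>The pseudoinverse of the grid Laplacian\<close>

text \<open>Penrose's argument: \<open>A * X = A * Y * (A * X)\<close>, and transposing this product
  of symmetric factors gives \<open>A * X * (A * Y) = A * Y\<close>. Likewise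
  \<open>X * A = Y * A\<close>, and then \<open>X = X * A * X = Y * A * Y = Y\<close>.\<close>

lemma is_pseudoinverse_unique:
  assumes X: "is_pseudoinverse A X" and Y: "is_pseudoinverse A Y"
  shows "X = Y"
proof -
  define r c where "r = dim_row A" and "c = dim_col A"
  have A: "A \<in> carrier_mat r c"
    by (simp add: r_def c_def)
  have Xc: "X \<in> carrier_mat c r" and X1: "A * X * A = A" and X2: "X * A * X = X"
    and X3: "transpose_mat (A * X) = A * X" and X4: "transpose_mat (X * A) = X * A"
    using X by (auto simp: is_pseudoinverse_def r_def c_def)
  have Yc: "Y \<in> carrier_mat c r" and Y1: "A * Y * A = A" and Y2: "Y * A * Y = Y"
    and Y3: "transpose_mat (A * Y) = A * Y" and Y4: "transpose_mat (Y * A) = Y * A"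
    using Y by (auto simp: is_pseudoinverse_def r_def c_def)
  have "A * X = (A * Y) * (A * X)"
    using assoc_mult_mat[of "A * Y" r r A c X r] A Xc Yc by (simp only: Y1) auto
  then have "A * X = transpose_mat ((A * Y) * (A * X))"
    using X3 by metis
  also have "\<dots> = (A * X) * (A * Y)"
    using A Xc Yc by (subst transpose_mult[of _ r r _ r]) (auto simp: X3 Y3)
  also have "\<dots> = A * Y"
    using assoc_mult_mat[of "A * X" r r A c Y r] A Xc Yc by (simp only: X1) auto
  finally have AX: "A * X = A * Y" .
  have "X * A = (X * A) * (Y * A)"
    using assoc_mult_mat[of X c r A c "Y * A" c] assoc_mult_mat[of A r c Y r A c] A Xc Yc
    by (simp only: Y1) auto
  then have "X * A = transpose_mat ((X * A) * (Y * A))"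
    using X4 by metis
  also have "\<dots> = (Y * A) * (X * A)"
    using A Xc Yc by (subst transpose_mult[of _ c c _ c]) (auto simp: X4 Y4)
  also have "\<dots> = Y * A"
    using assoc_mult_mat[of Y c r A c "X * A" c] assoc_mult_mat[of A r c X r A c] A Xc Yc
    by (simp only: X1) auto
  finally have XA: "X * A = Y * A" .
  have "X = X * A * X"
    by (simp only: X2)
  also have "\<dots> = Y * (A * X)"
    using XA A Xc Yc by (metis assoc_mult_mat)
  also have "\<dots> = Y * A * Y"
    using AX A Xc Yc by (metis assoc_mult_mat)
  also have "\<dots> = Y"
    by (rule Y2)
  finally show ?thesis .
qed

lemma pseudoinverse_eqI: "is_pseudoinverse A X \<Longrightarrow> pseudoinverse A = X"
  unfolding pseudoinverse_def by (rule the_equality) (auto intro: is_pseudoinverse_unique)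

text \<open>
  If \<open>K\<close> is the orthogonal projection onto the kernel of the symmetric matrix \<open>A\<close>, then \<open>A + K\<close> is
  invertible and \<open>(A + K)\<^sup>-\<^sup>1 - K\<close> is the pseudoinverse of \<open>A\<close>.
\<close>

lemma is_pseudoinverse_kernel_shift:
  fixes A K R :: "real mat"
  assumes A: "A \<in> carrier_mat N N" and K: "K \<in> carrier_mat N N" and R: "R \<in> carrier_mat N N"
    and AK: "A * K = 0\<^sub>m N N" and KA: "K * A = 0\<^sub>m N N" and KK: "K * K = K"
    and Kt: "transpose_mat K = K"
    and left: "R * (A + K) = 1\<^sub>m N" and right: "(A + K) * R = 1\<^sub>m N"
  shows "is_pseudoinverse A (R - K)" "A * (R - K) = 1\<^sub>m N - K"
proof -
  \<comment> \<open>\<open>A + K\<close> fixes \<open>K\<close> under multiplication, hence so does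
    its inverse \<open>R\<close>.\<close>
  have "R * K = R * ((A + K) * K)"
    using A K by (simp add: add_mult_distrib_mat[of _ N N] AK KK)
  also have "\<dots> = R * (A + K) * K"
    using A K R by (simp add: assoc_mult_mat[of _ N N _ N _ N])
  finally have RK: "R * K = K"
    using left K by simp
  have "K * R = K * (A + K) * R"
    using A K by (simp add: mult_add_distrib_mat[of _ N N] KA KK)
  also have "\<dots> = K * ((A + K) * R)"
    using A K R by (simp add: assoc_mult_mat[of _ N N _ N _ N])
  finally have KR: "K * R = K"
    using right K by simp
  have solve: "M = 1\<^sub>m N - K" if "M + K = 1\<^sub>m N" "M \<in> carrier_mat N N" for M
  proof (rule eq_matI)
    fix i j assume ij: "i < dim_row (1\<^sub>m N - K)" "j < dim_col (1\<^sub>m N - K)"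
    have "(M + K) $$ (i, j) = 1\<^sub>m N $$ (i, j)"
      by (simp only: that(1))
    then show "M $$ (i, j) = (1\<^sub>m N - K) $$ (i, j)"
      using ij K that(2) by simp
  qed (use K that(2) in auto)
  have AR: "A * R = 1\<^sub>m N - K"
  proof -
    have "A * R + K = 1\<^sub>m N"
      using right A K R by (simp add: add_mult_distrib_mat[of _ N N] KR)
    then show ?thesis
      using A R by (intro solve) auto
  qed
  have RA: "R * A = 1\<^sub>m N - K"
  proof -
    have "R * A + K = 1\<^sub>m N"
      using left A K R by (simp add: mult_add_distrib_mat[of _ N N] RK)
    then show ?thesis
      using A R by (intro solve) auto
  qed
  have 0: "M - 0\<^sub>m N N = M" if "M \<in> carrier_mat N N" for M :: "real mat"
    using that by (intro eq_matI) auto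
  show AX: "A * (R - K) = 1\<^sub>m N - K"
    using A K R by (simp add: mult_minus_distrib_mat[of _ N N] AR AK 0 minus_carrier_mat)
  have XA: "(R - K) * A = 1\<^sub>m N - K"
    using A K R by (simp add: minus_mult_distrib_mat[of _ N N] RA KA 0 minus_carrier_mat)
  have sym: "transpose_mat (1\<^sub>m N - K) = 1\<^sub>m N - K"
  proof (rule eq_matI)
    fix i j assume ij: "i < dim_row (1\<^sub>m N - K)" "j < dim_col (1\<^sub>m N - K)"
    have "K $$ (j, i) = K $$ (i, j)"
      using arg_cong[OF Kt, of "\<lambda>M. M $$ (i, j)"] ij K by simp
    then show "transpose_mat (1\<^sub>m N - K) $$ (i, j) = (1\<^sub>m N - K) $$ (i, j)"
      using ij K by auto
  qed (use K in auto)
  have "(1\<^sub>m N - K) * A = A"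
    using A K by (simp add: minus_mult_distrib_mat[of _ N N] KA 0)
  moreover have "(1\<^sub>m N - K) * (R - K) = R - K"
  proof -
    have "K * (R - K) = 0\<^sub>m N N"
      using K R by (simp add: mult_minus_distrib_mat[of _ N N] KR KK)
    moreover have "R - K \<in> carrier_mat N N"
      using K by (rule minus_carrier_mat)
    ultimately show ?thesis
      using K by (subst minus_mult_distrib_mat[of _ N N]) (auto simp: 0)
  qed
  ultimately show "is_pseudoinverse A (R - K)"
    using A K R unfolding is_pseudoinverse_def by (simp add: AX XA sym minus_carrier_mat)
qed

lemma mat_inverse_exists:
  fixes A :: "'a :: field mat"
  assumes A: "A \<in> carrier_mat N N"
    and inj: "\<And>x. x \<in> carrier_vec N \<Longrightarrow> A *\<^sub>v x = 0\<^sub>v N \<Longrightarrow> x = 0\<^sub>v N"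
  obtains R where "R \<in> carrier_mat N N" "R * A = 1\<^sub>m N" "A * R = 1\<^sub>m N"
proof -
  have "det A \<noteq> 0"
    using det_0_iff_vec_prod_zero_field[OF A] inj by blast
  from det_non_zero_imp_unit[OF A this, of undefined] that show thesis
    by (auto simp: Units_def ring_mat_def)
qed

section \<open>Constant functions as the kernel of the grid Laplacian\<close>

lemma sum_stencil_eq_0: "(\<Sum>w\<in>verts (grid m n). stencil m n \<phi> w) = 0"
  using grid_green[where \<phi> = \<phi> and \<pi> = "\<lambda>_. 1" and m = m and n = n] by simp

lemma card_verts_grid: "card (verts (grid m n)) = grid_size m n"
  by (simp add: grid_def grid_size_def)

lemma vertex_index_eq_iff:
  "x \<in> verts (grid m n) \<Longrightarrow> y \<in> verts (grid m n) \<Longrightarrow>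
    vertex_index n x = vertex_index n y \<longleftrightarrow> x = y"
  by (metis index_vertex_index)

text \<open>The orthogonal projection onto the constant vectors, the \<open>K\<close> of the kernel
  shift.\<close>

definition averaging_mat :: "nat \<Rightarrow> real mat" where
  "averaging_mat N = mat N N (\<lambda>_. 1 / real N)"

lemma averaging_mat_carrier [simp]: "averaging_mat N \<in> carrier_mat N N"
  by (simp add: averaging_mat_def)

lemma averaging_mat_mult_vec:
  "x \<in> carrier_vec N \<Longrightarrow> i < N \<Longrightarrow> (averaging_mat N *\<^sub>v x) $ i = (\<Sum>k = 0..<N. x $ k) / real N"
  by (simp add: averaging_mat_def scalar_prod_def sum_divide_distrib)

lemma averaging_mat_idem: "averaging_mat N * averaging_mat N = averaging_mat N"
  by (rule eq_matI) (auto simp: averaging_mat_def scalar_prod_def)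

lemma grid_laplacian_sym: "transpose_mat (grid_laplacian m n a) = grid_laplacian m n a"
  by (rule eq_matI) (auto simp: grid_laplacian_def Let_def grid_adjacent_def)

lemma grid_laplacian_mult_averaging:
  "grid_laplacian m n a * averaging_mat (grid_size m n) = 0\<^sub>m (grid_size m n) (grid_size m n)"
  (is "?L * ?K = 0\<^sub>m ?N ?N")
proof (rule eq_matI)
  fix i j assume ij: "i < dim_row (0\<^sub>m ?N ?N)" "j < dim_col (0\<^sub>m ?N ?N)"
  have const: "stencil m n (vec_potential n (vec ?N (\<lambda>_. 1 / real ?N))) w = 0"
    if w: "w \<in> verts (grid m n)" for w
  proof -
    obtain k l where kl: "w = (k, l)" "k \<le> m" "l \<le> n"
      using w by (cases w) auto
    have "vec_potential n (vec ?N (\<lambda>_. 1 / real ?N)) (i', j') = 1 / real ?N" if "i' \<le> m" "j' \<le> n" for i' j'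
      using vertex_index_less[of "(i', j')" m n] that by (simp add: vec_potential_def)
    with kl show ?thesis
      by (simp add: stencil_def)
  qed
  have "(?L * ?K) $$ (i, j) = (?L *\<^sub>v col ?K j) $ i"
    using ij carrier_matD[OF grid_laplacian_carrier[of m n a]] carrier_matD[OF averaging_mat_carrier[of ?N]]
    by simp
  also have "col ?K j = vec ?N (\<lambda>_. 1 / real ?N)"
    using ij by (intro eq_vecI) (auto simp: averaging_mat_def)
  finally show "(?L * ?K) $$ (i, j) = 0\<^sub>m ?N ?N $$ (i, j)"
    using ij by (simp add: grid_laplacian_mult_vec const index_vertex_in_verts)
qed (use carrier_matD[OF grid_laplacian_carrier[of m n a]] in \<open>auto simp: averaging_mat_def\<close>)

text \<open>Summing the equations over all vertices removes the Laplacian and leaves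
  \<open>S = 0\<close>. Then \<open>x\<close> has vanishing stencil, so it is constant, and its zero
  sum makes it 0.\<close>

lemma grid_laplacian_shift_injective:
  assumes a: "a > 0" and x: "x \<in> carrier_vec (grid_size m n)"
    and zero: "(grid_laplacian m n a + averaging_mat (grid_size m n)) *\<^sub>v x = 0\<^sub>v (grid_size m n)"
  shows "x = 0\<^sub>v (grid_size m n)"
proof -
  let ?N = "grid_size m n" and ?\<phi> = "vec_potential n x"
  have N: "real ?N > 0"
    unfolding of_nat_0_less_iff by (simp add: grid_size_def)
  define S where "S = (\<Sum>w\<in>verts (grid m n). ?\<phi> w)"
  have S: "(\<Sum>k = 0..<?N. x $ k) = S"
    using sum_index_vertex[of ?\<phi> n m] by (simp add: S_def vec_potential_def vertex_index_vertex)
  have eq: "stencil m n ?\<phi> w / a + S / real ?N = 0" if w: "w \<in> verts (grid m n)" for w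
  proof -
    let ?k = "vertex_index n w"
    have k: "?k < ?N"
      using w by (rule vertex_index_less)
    have "0 = ((grid_laplacian m n a + averaging_mat ?N) *\<^sub>v x) $ ?k"
      using zero k by simp
    also have "\<dots> = (grid_laplacian m n a *\<^sub>v x) $ ?k + (averaging_mat ?N *\<^sub>v x) $ ?k"
      using k x carrier_matD[OF grid_laplacian_carrier[of m n a]] carrier_matD[OF averaging_mat_carrier[of ?N]]
      by (subst add_mult_distrib_mat_vec[of _ ?N ?N]) auto
    finally show ?thesis
      using k w x by (simp add: grid_laplacian_mult_vec averaging_mat_mult_vec S index_vertex_index
          del: index_mult_mat_vec)
  qed
  have "0 = (\<Sum>w\<in>verts (grid m n). stencil m n ?\<phi> w / a + S / real ?N)"
    using eq by simp
  also have "\<dots> = S"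
    using N by (simp add: sum.distrib sum_stencil_eq_0 card_verts_grid flip: sum_divide_distrib)
  finally have S0: "S = 0" by simp
  then have "stencil m n ?\<phi> w = 0" if "w \<in> verts (grid m n)" for w
    using eq[OF that] a by simp
  then have const: "?\<phi> w = ?\<phi> (0, 0)" if "w \<in> verts (grid m n)" for w
    using stencil_zero_imp_constant that by blast
  have "S = (\<Sum>w\<in>verts (grid m n). ?\<phi> (0, 0))"
    unfolding S_def by (rule sum.cong[OF refl const])
  then have "S = real ?N * ?\<phi> (0, 0)"
    by (simp only: sum_constant card_verts_grid)
  then have "?\<phi> (0, 0) = 0"
    using S0 N by simp
  then have "?\<phi> w = 0" if "w \<in> verts (grid m n)" for w
    using const[OF that] by simp
  then have "x $ k = 0" if "k < ?N" for k
    using index_vertex_in_verts[OF that] by (metis vec_potential_def vertex_index_vertex)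
  then show ?thesis
    using x by (intro eq_vecI) auto
qed

lemma grid_laplacian_pseudoinverse:
  assumes "a > 0"
  shows "pseudoinverse (grid_laplacian m n a) \<in> carrier_mat (grid_size m n) (grid_size m n)"
    and "grid_laplacian m n a * pseudoinverse (grid_laplacian m n a) =
      1\<^sub>m (grid_size m n) - averaging_mat (grid_size m n)"
proof -
  let ?N = "grid_size m n" and ?L = "grid_laplacian m n a" and ?K = "averaging_mat (grid_size m n)"
  obtain R where R: "R \<in> carrier_mat ?N ?N" "R * (?L + ?K) = 1\<^sub>m ?N" "(?L + ?K) * R = 1\<^sub>m ?N"
    by (rule mat_inverse_exists[of "?L + ?K" ?N])
      (use grid_laplacian_shift_injective[OF assms] in auto)
  have Kt: "transpose_mat ?K = ?K"
    by (rule eq_matI) (auto simp: averaging_mat_def)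
  \<comment> \<open>Both factors are symmetric, so this is the transpose of the product already
    computed.\<close>
  have KL: "?K * ?L = 0\<^sub>m ?N ?N"
  proof -
    have "?K * ?L = transpose_mat (?L * ?K)"
      by (subst transpose_mult[of _ ?N ?N _ ?N]) (simp_all add: Kt grid_laplacian_sym)
    then show ?thesis
      by (simp add: grid_laplacian_mult_averaging)
  qed
  note X = is_pseudoinverse_kernel_shift[OF grid_laplacian_carrier averaging_mat_carrier R(1)
      grid_laplacian_mult_averaging KL averaging_mat_idem Kt R(2,3)]
  then have eq: "pseudoinverse ?L = R - ?K"
    by (intro pseudoinverse_eqI)
  show "pseudoinverse ?L \<in> carrier_mat ?N ?N"
    using averaging_mat_carrier unfolding eq by (rule minus_carrier_mat)
  show "?L * pseudoinverse ?L = 1\<^sub>m ?N - ?K"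
    using X(2) by (simp add: eq)
qed

section \<open>Dipole potentials and reciprocity\<close>

definition dipole_potential :: "nat \<Rightarrow> nat \<Rightarrow> real \<Rightarrow> vertex \<Rightarrow> vertex \<Rightarrow> vertex \<Rightarrow> real" where
  "dipole_potential m n a x y =
     vec_potential n (pseudoinverse (grid_laplacian m n a) *\<^sub>v (vertex_unit m n x - vertex_unit m n y))"

text \<open>The Laplacian times its pseudoinverse is the identity minus averaging, and averaging
  kills a dipole because its entries sum to 0. So the potential is the voltage of a unit current
  entering at \<open>x\<close> and leaving at \<open>y\<close>.\<close>

lemma stencil_dipole_potential:
  assumes a: "a > 0" and x: "x \<in> verts (grid m n)" and y: "y \<in> verts (grid m n)"
    and w: "w \<in> verts (grid m n)"
  shows "stencil m n (dipole_potential m n a x y) w = a * (of_bool (w = x) - of_bool (w = y))"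
proof -
  let ?N = "grid_size m n" and ?L = "grid_laplacian m n a"
  let ?X = "pseudoinverse ?L" and ?d = "vertex_unit m n x - vertex_unit m n y"
  let ?k = "vertex_index n w"
  note X = grid_laplacian_pseudoinverse[OF a, of m n]
  have k: "?k < ?N"
    using w by (rule vertex_index_less)
  have d: "?d \<in> carrier_vec ?N"
    by (simp add: vertex_unit_def)
  have entry: "?d $ i = of_bool (i = vertex_index n x) - of_bool (i = vertex_index n y)" if "i < ?N" for i
    using that vertex_index_less[OF x] vertex_index_less[OF y] by (simp add: vertex_unit_def unit_vec_def)
  have "(\<Sum>i = 0..<?N. ?d $ i) =
      (\<Sum>i = 0..<?N. of_bool (i = vertex_index n x)) - (\<Sum>i = 0..<?N. of_bool (i = vertex_index n y))"
    using entry by (simp add: sum_subtractf)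
  also have "\<dots> = 0"
    using vertex_index_less[OF x] vertex_index_less[OF y] by (simp add: of_bool_def)
  finally have sum0: "(\<Sum>i = 0..<?N. ?d $ i) = 0" .
  have "(?L *\<^sub>v (?X *\<^sub>v ?d)) $ ?k = ((1\<^sub>m ?N - averaging_mat ?N) *\<^sub>v ?d) $ ?k"
    using X d by (simp flip: assoc_mult_mat_vec[of _ ?N ?N _ ?N])
  also have "\<dots> = (1\<^sub>m ?N *\<^sub>v ?d) $ ?k - (averaging_mat ?N *\<^sub>v ?d) $ ?k"
    using k d by (subst minus_mult_distrib_mat_vec[of _ ?N ?N]) (auto simp: averaging_mat_def)
  also have "\<dots> = ?d $ ?k"
    using k d by (simp only: averaging_mat_mult_vec sum0 one_mult_mat_vec div_0 diff_0_right)
  finally have "stencil m n (dipole_potential m n a x y) w / a = ?d $ ?k"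
    using X k w d by (subst (asm) grid_laplacian_mult_vec) (auto simp: dipole_potential_def index_vertex_index)
  also have "\<dots> = of_bool (w = x) - of_bool (w = y)"
    using entry[OF k] w x y by (simp add: vertex_index_eq_iff)
  finally show ?thesis
    using a by (simp add: field_simps)
qed

text \<open>
  Reciprocity, i.e. Green's identity applied to the dipoles at \<open>s\<close>, \<open>t\<close> and at \<open>u\<close>, \<open>v\<close>.
\<close>

lemma chord_voltage_eq:
  assumes a: "a > 0" and u: "u \<in> verts (grid m n)" and v: "v \<in> verts (grid m n)"
    and \<phi>: "\<And>w. w \<in> verts (grid m n) \<Longrightarrow>
      stencil m n \<phi> w = a * q * (of_bool (w = (0, 0)) - of_bool (w = (m, n)))"
  shows "chord_voltage m n a q u v = \<phi> u - \<phi> v"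
    and "chord_voltage m n a q u v =
      q * (dipole_potential m n a u v (0, 0) - dipole_potential m n a u v (m, n))"
proof -
  let ?\<psi> = "dipole_potential m n a u v" and ?V = "verts (grid m n)"
  have fin: "finite ?V"
    by (simp add: grid_def)
  have st: "(0, 0) \<in> ?V" "(m, n) \<in> ?V"
    by simp_all
  have pick: "(\<Sum>w\<in>?V. g w * (c * (of_bool (w = x) - of_bool (w = y)))) = c * (g x - g y)"
    if "x \<in> ?V" "y \<in> ?V" for g x y and c :: real
  proof -
    have "(\<Sum>w\<in>?V. g w * (c * (of_bool (w = x) - of_bool (w = y)))) =
        (\<Sum>w\<in>?V. (if w = x then c * g w else 0) - (if w = y then c * g w else 0))"
      by (intro sum.cong) (auto simp: algebra_simps)
    then show ?thesis
      using that fin by (simp add: sum_subtractf algebra_simps)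
  qed
  have "(\<Sum>e\<in>arcs (grid m n). (?\<psi> (fst e) - ?\<psi> (snd e)) * (\<phi> (fst e) - \<phi> (snd e))) = a * (\<phi> u - \<phi> v)"
    using stencil_dipole_potential[OF a u v] pick[OF u v] by (simp add: grid_green)
  moreover have "(\<Sum>e\<in>arcs (grid m n). (\<phi> (fst e) - \<phi> (snd e)) * (?\<psi> (fst e) - ?\<psi> (snd e))) =
      a * q * (?\<psi> (0, 0) - ?\<psi> (m, n))"
    using \<phi> pick[OF st] by (simp add: grid_green)
  ultimately have green: "\<phi> u - \<phi> v = q * (?\<psi> (0, 0) - ?\<psi> (m, n))"
    using a by (simp add: mult.commute)
  let ?z = "pseudoinverse (grid_laplacian m n a) *\<^sub>v (vertex_unit m n u - vertex_unit m n v)"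
  have "?z \<in> carrier_vec (grid_size m n)"
    using grid_laplacian_pseudoinverse(1)[OF a] by (intro mult_mat_vec_carrier) (auto simp: vertex_unit_def)
  then show *: "chord_voltage m n a q u v = q * (?\<psi> (0, 0) - ?\<psi> (m, n))"
    unfolding chord_voltage_def dipole_potential_def vec_potential_def
    using vertex_index_less[OF st(1)] vertex_index_less[OF st(2)]
    by (subst minus_scalar_prod_distrib[of _ "grid_size m n"]) (simp_all add: vertex_unit_def)
  show "chord_voltage m n a q u v = \<phi> u - \<phi> v"
    by (simp only: * green)
qed

section \<open>The effect of a chord\<close>

text \<open>Stated for any digraph containing the grid arcs, to serve with and without the
  chord.\<close>

lemma grid_reachable:
  assumes "wf_digraph G" and arcs: "arcs (grid m n) \<subseteq> arcs G"
    and tail: "tail G = fst" and head: "head G = snd" and source: "(0, 0) \<in> verts G"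
  shows "(0, 0) \<rightarrow>\<^sup>*\<^bsub>G\<^esub> (m, n)"
proof -
  interpret wf_digraph G
    by fact
  have "(0, 0) \<rightarrow>\<^sup>*\<^bsub>G\<^esub> (i, 0)" if "i \<le> m" for i
    using that
  proof (induction i)
    case 0
    show ?case using source by simp
  next
    case (Suc i)
    then have "((i, 0), (Suc i, 0)) \<in> arcs G"
      using arcs by (auto simp: mem_arcs_grid)
    then have "arc ((i, 0), (Suc i, 0)) ((i, 0), (Suc i, 0))"
      by (simp add: arc_def tail head)
    with Suc show ?case
      using reachable_arc_trans by fastforce
  qed
  then have row: "(0, 0) \<rightarrow>\<^sup>*\<^bsub>G\<^esub> (m, 0)"
    by simp
  have "(0, 0) \<rightarrow>\<^sup>*\<^bsub>G\<^esub> (m, j)" if "j \<le> n" for j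
    using that
  proof (induction j)
    case 0
    show ?case by (rule row)
  next
    case (Suc j)
    then have "((m, j), (m, Suc j)) \<in> arcs G"
      using arcs by (auto simp: mem_arcs_grid)
    then have "arc ((m, j), (m, Suc j)) ((m, j), (m, Suc j))"
      by (simp add: arc_def tail head)
    with Suc show ?case
      using reachable_arc_trans by fastforce
  qed
  then show ?thesis by simp
qed

text \<open>This turns the constant latency \<open>b\<close> into the drop of the potential
  \<open>- b * level\<close>.\<close>

lemma level_head_grid:
  "e \<in> arcs (grid m n) \<Longrightarrow> level (snd e) = level (fst e) + 1"
  by (auto simp: grid_def level_def)

text \<open>Finitely many strict inequalities survive a small perturbation; this later chooses the
  chord flow.\<close>

lemma exists_pos_scaling:
  fixes p r :: "'e \<Rightarrow> real"
  assumes "finite A" "\<And>e. e \<in> A \<Longrightarrow> p e > 0"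
  obtains y where "y > 0" "\<And>e. e \<in> A \<Longrightarrow> y * r e \<le> p e"
proof -
  have "\<forall>\<^sub>F y in at_right 0. y * r e < p e" if "e \<in> A" for e
  proof (rule order_tendstoD(2))
    show "((\<lambda>y. y * r e) \<longlongrightarrow> 0 * r e) (at_right 0)"
      by (intro tendsto_intros)
  qed (use assms that in simp)
  then have "\<forall>\<^sub>F y in at_right 0. \<forall>e\<in>A. y * r e < p e"
    by (intro eventually_ball_finite assms(1)) blast
  then have "\<forall>\<^sub>F y in at_right (0 :: real). y > 0 \<and> (\<forall>e\<in>A. y * r e < p e)"
    by (intro eventually_conj eventually_at_right_less)
  then obtain y where "y > 0" "\<forall>e\<in>A. y * r e < p e"
    using eventually_happens' trivial_limit_at_right_real by blast
  with that show thesis by (meson less_imp_le)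
qed

section \<open>The networks with and without the chord, and the electrical flow\<close>

locale chord_grid =
  fixes m n :: nat and a q :: real and u v :: vertex
  assumes m: "m \<ge> 1" and a: "a > 0" and q: "q > 0"
    and chord: "is_chord m n u v"
begin

abbreviation "\<G> \<equiv> grid m n"
abbreviation "\<G>' \<equiv> grid_with_chord m n u v"

lemma u: "u \<in> verts \<G>" and v: "v \<in> verts \<G>" and chord_not_arc: "(u, v) \<notin> arcs \<G>"
  using chord by (auto simp: is_chord_def grid_adjacent_def)

lemma verts_chord [simp]: "verts \<G>' = verts \<G>"
  and arcs_chord [simp]: "arcs \<G>' = insert (u, v) (arcs \<G>)"
  and tail_chord [simp]: "tail \<G>' = fst"
  and head_chord [simp]: "head \<G>' = snd"
  using u v by (auto simp: grid_with_chord_def pre_digraph.add_arc_def)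

sublocale old: fin_digraph \<G>
  by (rule fin_digraph_grid)

sublocale new: fin_digraph \<G>'
proof
  fix e assume "e \<in> arcs \<G>'"
  then show "tail \<G>' e \<in> verts \<G>'" "head \<G>' e \<in> verts \<G>'"
    using u v old.wellformed[of e] by auto
qed auto

lemma arc_not_chord: "e \<in> arcs \<G> \<Longrightarrow> e \<noteq> (u, v)"
  using chord_not_arc by auto

lemma net_outflow_chord:
  assumes "w \<in> verts \<G>"
  shows "net_outflow \<G>' f w =
    net_outflow \<G> f w + f (u, v) * (of_bool (u = w) - of_bool (v = w))"
  using assms chord_not_arc by (simp add: old.net_outflow_eq_sum_arcs new.net_outflow_eq_sum_arcs)

lemma old_network:
  assumes "b \<ge> 0"
  shows "affine_network \<G> (0, 0) (m, n) q (\<lambda>_. a) (\<lambda>_. b)"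
  using assms a q m grid_reachable[OF old.wf_digraph, of m n] by unfold_locales auto

lemma new_network:
  assumes "b \<ge> 0" "c \<ge> 0" "d \<ge> 0"
  shows "affine_network \<G>' (0, 0) (m, n) q
    (\<lambda>e. if e = (u, v) then c else a) (\<lambda>e. if e = (u, v) then d else b)"
  using assms a q m grid_reachable[OF new.wf_digraph, of m n] by unfold_locales auto

lemma old_latency:
  assumes "b \<ge> 0"
  shows "affine_network.latency (\<lambda>_. a) (\<lambda>_. b) = grid_latency a b"
  by (intro ext) (simp add: affine_network.latency_def[OF old_network[OF assms]] grid_latency_def)

lemma new_latency:
  assumes "b \<ge> 0" "c \<ge> 0" "d \<ge> 0"
  shows "affine_network.latency (\<lambda>e. if e = (u, v) then c else a) (\<lambda>e. if e = (u, v) then d else b) =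
    chord_latency a b c d u v"
  by (intro ext) (simp add: affine_network.latency_def[OF new_network[OF assms]] chord_latency_def)

text \<open>The voltage when \<open>q\<close> units of current pass from source to sink.\<close>

definition \<phi> :: "vertex \<Rightarrow> real" where
  "\<phi> w = q * dipole_potential m n a (0, 0) (m, n) w"

abbreviation \<psi> :: "vertex \<Rightarrow> real" where
  "\<psi> \<equiv> dipole_potential m n a u v"

lemma stencil_\<phi>:
  "w \<in> verts \<G> \<Longrightarrow> stencil m n \<phi> w = a * q * (of_bool (w = (0, 0)) - of_bool (w = (m, n)))"
proof -
  assume w: "w \<in> verts \<G>"
  have "stencil m n \<phi> w = q * stencil m n (dipole_potential m n a (0, 0) (m, n)) w"
    by (simp add: stencil_def \<phi>_def algebra_simps split: prod.split)
  with w show ?thesis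
    by (simp add: stencil_dipole_potential a)
qed

text \<open>The first form enters the bound on the new cost, the second the exact cost of the
  superimposed flow.\<close>

lemma voltage: "chord_voltage m n a q u v = \<phi> u - \<phi> v"
    "chord_voltage m n a q u v = q * (\<psi> (0, 0) - \<psi> (m, n))"
  using chord_voltage_eq[OF a u v stencil_\<phi>] by auto

lemma \<phi>_decreasing: "e \<in> arcs \<G> \<Longrightarrow> \<phi> (snd e) < \<phi> (fst e)"
  by (rule stencil_strictly_decreasing_arc[of "a * q", OF _ stencil_\<phi>]) (use a q in auto)

text \<open>The value 0 on the chord makes the electrical flow feasible in both networks.\<close>

definition base_flow :: "vertex \<times> vertex \<Rightarrow> real" where
  "base_flow e = (if e = (u, v) then 0 else (\<phi> (fst e) - \<phi> (snd e)) / a)"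

lemma base_flow_chord: "base_flow (u, v) = 0"
  by (simp add: base_flow_def)

lemma slope_base_flow: "e \<in> arcs \<G> \<Longrightarrow> a * base_flow e = \<phi> (fst e) - \<phi> (snd e)"
  using a arc_not_chord[of e] by (simp add: base_flow_def)

lemma net_outflow_potential:
  assumes "w \<in> verts \<G>" and "\<And>e. e \<in> arcs \<G> \<Longrightarrow> f e = (\<pi> (fst e) - \<pi> (snd e)) / a"
  shows "net_outflow \<G> f w = stencil m n \<pi> w / a"
proof -
  have "net_outflow \<G> f w = net_outflow \<G> (\<lambda>e. \<pi> (fst e) - \<pi> (snd e)) w / a"
    using assms
    by (simp add: old.net_outflow_eq_sum_arcs sum_divide_distrib)
  then show ?thesis
    by (simp only: net_outflow_grid[OF assms(1)])
qed

lemma net_outflow_base_flow: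
  assumes "w \<in> verts \<G>"
  shows "net_outflow \<G> base_flow w = q * (of_bool (w = (0, 0)) - of_bool (w = (m, n)))"
proof -
  have "net_outflow \<G> base_flow w = stencil m n \<phi> w / a"
    using assms by (rule net_outflow_potential) (auto simp: base_flow_def dest: arc_not_chord)
  then show ?thesis
    using a assms by (simp add: stencil_\<phi>)
qed

lemma feasible_flowI:
  assumes "\<And>e. e \<in> arcs G \<Longrightarrow> f e \<ge> 0" and "verts G = verts \<G>"
    and "\<And>w. w \<in> verts \<G> \<Longrightarrow> net_outflow G f w = q * (of_bool (w = (0, 0)) - of_bool (w = (m, n)))"
  shows "feasible_flow G (0, 0) (m, n) q f"
  using assms m by (auto simp: feasible_flow_def)

lemma base_flow_nonneg: "e \<in> arcs \<G> \<Longrightarrow> base_flow e \<ge> 0"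
  using \<phi>_decreasing[of e] a by (simp add: base_flow_def)

lemma base_flow_feasible_old: "feasible_flow \<G> (0, 0) (m, n) q base_flow"
  by (rule feasible_flowI) (auto simp: base_flow_nonneg net_outflow_base_flow simp del: mem_verts_grid)

lemma base_flow_feasible_new: "feasible_flow \<G>' (0, 0) (m, n) q base_flow"
proof (rule feasible_flowI)
  fix e assume "e \<in> arcs \<G>'"
  then show "base_flow e \<ge> 0"
    using base_flow_nonneg[of e] by (cases "e = (u, v)") (simp_all add: base_flow_chord)
next
  fix w assume "w \<in> verts \<G>"
  then show "net_outflow \<G>' base_flow w = q * (of_bool (w = (0, 0)) - of_bool (w = (m, n)))"
    by (simp add: net_outflow_chord net_outflow_base_flow base_flow_chord)
qed simp

section \<open>Equilibrium costs with and without the chord\<close>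

abbreviation cost_old :: "real \<Rightarrow> real" where
  "cost_old b \<equiv> equilibrium_cost \<G> (grid_latency a b) (0, 0) (m, n) q"

abbreviation cost_new :: "real \<Rightarrow> real \<Rightarrow> real \<Rightarrow> real" where
  "cost_new b c d \<equiv> equilibrium_cost \<G>' (chord_latency a b c d u v) (0, 0) (m, n) q"

lemma cost_old_eq:
  assumes b: "b \<ge> 0"
  shows "cost_old b = q * (\<phi> (0, 0) - \<phi> (m, n) + b * real (m + n))"
proof -
  interpret affine_network \<G> "(0, 0)" "(m, n)" q "\<lambda>_. a" "\<lambda>_. b"
    using b by (rule old_network)
  let ?\<pi> = "\<lambda>w. \<phi> w - b * real (level w)"
  have "equilibrium_cost \<G> latency (0, 0) (m, n) q = q * (?\<pi> (0, 0) - ?\<pi> (m, n))"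
  proof (rule potential_flow_cost[OF base_flow_feasible_old])
    fix e assume e: "e \<in> arcs \<G>"
    show "latency e (base_flow e) = ?\<pi> (tail \<G> e) - ?\<pi> (head \<G> e)"
      by (simp add: latency_def slope_base_flow[OF e] level_head_grid[OF e] algebra_simps)
  qed
  then show ?thesis
    by (simp add: old_latency[OF b] level_def algebra_simps)
qed

text \<open>Up to the factor \<open>q\<close>, the voltage drop is the energy of the electrical
  flow, which is positive on every arc.\<close>

lemma \<phi>_source_sink: "\<phi> (0, 0) > \<phi> (m, n)"
proof -
  have "(\<Sum>e\<in>arcs \<G>. base_flow e * (\<phi> (fst e) - \<phi> (snd e))) = q * (\<phi> (0, 0) - \<phi> (m, n))"
    using old.feasible_flow_potential_drop[OF base_flow_feasible_old, of \<phi>] m by simp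
  moreover have "(\<Sum>e\<in>arcs \<G>. base_flow e * (\<phi> (fst e) - \<phi> (snd e))) > 0"
  proof (rule sum_pos)
    show "arcs \<G> \<noteq> {}"
      using m mem_arcs_grid[of 0 0 1 0 m n] by auto
  qed (use \<phi>_decreasing a in \<open>auto simp: base_flow_def zero_less_divide_iff dest: arc_not_chord\<close>)
  ultimately show ?thesis
    using q by (simp add: zero_less_mult_iff)
qed

lemma cost_old_pos: "b \<ge> 0 \<Longrightarrow> cost_old b > 0"
  using \<phi>_source_sink q by (simp add: cost_old_eq add_pos_nonneg)

lemma cost_new_bounds:
  assumes b: "b \<ge> 0" and c: "c \<ge> 0" and d: "d \<ge> 0"
  obtains y where "y \<ge> 0" "cost_new b c d \<le> cost_old b - y * (\<phi> u - \<phi> v)"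
    "0 \<le> y * (\<phi> u - \<phi> v + b * real_of_int (level_gain u v))"
proof -
  interpret affine_network \<G>' "(0, 0)" "(m, n)" q
    "\<lambda>e. if e = (u, v) then c else a" "\<lambda>e. if e = (u, v) then d else b"
    using b c d by (rule new_network)
  obtain f where f: "variational_equilibrium f"
    using user_equilibrium_exists user_equilibrium_imp_variational by blast
  then have feas: "feasible_flow \<G>' (0, 0) (m, n) q f"
    by (simp add: variational_equilibrium_def)
  define y where "y = f (u, v)"
  have y: "y \<ge> 0"
    using feas by (auto simp: feasible_flow_def y_def)
  let ?g = base_flow and ?C = "cost_new b c d"
  \<comment> \<open>The flow \<open>h'\<close> priced at the grid latencies caused by
    \<open>h\<close>.\<close>
  define S where "S h h' = (\<Sum>e\<in>arcs \<G>. (a * h e + b) * h' e)" for h h'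
  have ne: "(0 :: nat, 0 :: nat) \<noteq> (m, n)"
    using m by simp
  have drop_new: "(\<Sum>e\<in>arcs \<G>. f e * (\<pi> (fst e) - \<pi> (snd e))) =
      q * (\<pi> (0, 0) - \<pi> (m, n)) - y * (\<pi> u - \<pi> v)" for \<pi>
    using new.feasible_flow_potential_drop[OF feas _ _ ne, of \<pi>] chord_not_arc
    by (simp add: y_def)
  have drop_old: "(\<Sum>e\<in>arcs \<G>. ?g e * (\<pi> (fst e) - \<pi> (snd e))) = q * (\<pi> (0, 0) - \<pi> (m, n))" for \<pi>
    using old.feasible_flow_potential_drop[OF base_flow_feasible_old _ _ ne, of \<pi>] by simp
  have lat: "latency e x = a * x + b" if "e \<in> arcs \<G>" for e x
    using arc_not_chord[OF that] by (simp add: latency_def)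
  have C: "?C = flow_cost \<G>' latency f"
    using equilibrium_cost_eqI[OF f] by (simp add: new_latency[OF b c d])
  have C_eq: "?C = y * (c * y + d) + S f f"
    using chord_not_arc by (simp add: C flow_cost_def S_def lat latency_def[of "(u, v)"] y_def mult.commute)
  have "?C \<le> (\<Sum>e\<in>arcs \<G>'. ?g e * latency e (f e))"
    using f base_flow_feasible_new by (auto simp: C variational_equilibrium_def)
  also have "\<dots> = S f ?g"
    using chord_not_arc by (simp add: S_def lat base_flow_chord mult.commute)
  finally have C_le: "?C \<le> S f ?g" .
  let ?\<pi> = "\<lambda>w. \<phi> w - b * real (level w)"
  have g_lat: "a * ?g e + b = ?\<pi> (fst e) - ?\<pi> (snd e)" if "e \<in> arcs \<G>" for e
    by (simp add: slope_base_flow[OF that] level_head_grid[OF that] algebra_simps)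
  have Sg: "S ?g h = (\<Sum>e\<in>arcs \<G>. h e * (?\<pi> (fst e) - ?\<pi> (snd e)))" for h
    unfolding S_def by (intro sum.cong refl) (simp only: g_lat mult.commute)
  have Sgg: "S ?g ?g = cost_old b"
    unfolding Sg drop_old[of ?\<pi>] cost_old_eq[OF b] by (simp add: level_def algebra_simps)
  have Sgf: "S ?g f = cost_old b - y * (\<phi> u - \<phi> v + b * real_of_int (level_gain u v))"
    unfolding Sg drop_new[of ?\<pi>] cost_old_eq[OF b] by (simp add: level_def level_gain_def algebra_simps)
  \<comment> \<open>The bilinear part of \<open>S\<close> is symmetric, so only \<open>b\<close>
    times the total arc flows remains. These totals come from the potential \<open>- level\<close>,
    which drops by 1 along each grid arc.\<close>
  have "S f ?g - S ?g f = b * ((\<Sum>e\<in>arcs \<G>. ?g e) - (\<Sum>e\<in>arcs \<G>. f e))"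
    by (simp add: S_def algebra_simps sum_distrib_left flip: sum_subtractf sum.distrib)
  also have "(\<Sum>e\<in>arcs \<G>. ?g e) = q * real (m + n)"
    using drop_old[of "\<lambda>w. - real (level w)"] by (simp add: level_head_grid) (simp add: level_def)
  also have "(\<Sum>e\<in>arcs \<G>. f e) = q * real (m + n) - y * real_of_int (level_gain u v)"
    using drop_new[of "\<lambda>w. - real (level w)"]
    by (simp add: level_head_grid) (simp add: level_def level_gain_def algebra_simps)
  finally have Sfg: "S f ?g = cost_old b - y * (\<phi> u - \<phi> v)"
    by (simp add: Sgf algebra_simps)
  have "0 \<le> (\<Sum>e\<in>arcs \<G>. a * (f e - ?g e)\<^sup>2)"
    using a by (intro sum_nonneg) auto
  \<comment> \<open>The terms with \<open>b\<close> cancel.\<close>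
  also have "\<dots> = S f f - S f ?g - (S ?g f - S ?g ?g)"
    by (simp add: S_def power2_eq_square algebra_simps flip: sum_subtractf sum.distrib)
  \<comment> \<open>\<open>C_eq\<close> and \<open>C_le\<close> bound the first difference by the
    negated chord cost; \<open>Sgf\<close> and \<open>Sgg\<close> evaluate the second.\<close>
  also have "\<dots> \<le> y * (\<phi> u - \<phi> v + b * real_of_int (level_gain u v)) - y * (c * y + d)"
    using C_eq C_le Sgf Sgg by simp
  finally have "y * (c * y + d) \<le> y * (\<phi> u - \<phi> v + b * real_of_int (level_gain u v))"
    by simp
  moreover have "0 \<le> y * (c * y + d)"
    using y c d by simp
  ultimately show thesis
    using that[OF y] C_le Sfg by simp
qed

section \<open>The two directions of the equivalence\<close>

lemma braess_ratio_gt_1_iff: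
  assumes "b \<ge> 0"
  shows "braess_ratio m n q a b c d u v > 1 \<longleftrightarrow> cost_new b c d > cost_old b"
  using cost_old_pos[OF assms] by (simp add: braess_ratio_def less_divide_eq)

lemma braess_capable_imp:
  assumes "braess_capable m n a q u v"
  shows "chord_voltage m n a q u v < 0 \<and> level_gain u v > 0"
proof -
  obtain b c d where bcd: "b \<ge> 0" "c \<ge> 0" "d \<ge> 0" and gt: "cost_new b c d > cost_old b"
    using assms by (auto simp: braess_capable_def braess_ratio_gt_1_iff)
  obtain y where y: "y \<ge> 0" "cost_new b c d \<le> cost_old b - y * (\<phi> u - \<phi> v)"
    "0 \<le> y * (\<phi> u - \<phi> v + b * real_of_int (level_gain u v))"
    using bcd by (rule cost_new_bounds)
  have "y * (\<phi> u - \<phi> v) < 0"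
    using y(2) gt by simp
  with y(1) have neg: "\<phi> u - \<phi> v < 0" and "y > 0"
    by (auto simp: mult_less_0_iff)
  with y(3) have "b * real_of_int (level_gain u v) > 0"
    by (simp add: zero_le_mult_iff)
  with bcd(1) have "level_gain u v > 0"
    by (simp add: zero_less_mult_iff)
  with neg show ?thesis
    by (simp add: voltage(1))
qed

lemma braess_capableI:
  assumes V: "chord_voltage m n a q u v < 0" and k: "level_gain u v > 0"
  shows "braess_capable m n a q u v"
proof -
  obtain y where y: "y > 0"
    and small: "\<And>e. e \<in> arcs \<G> \<Longrightarrow> y * (\<psi> (fst e) - \<psi> (snd e)) \<le> \<phi> (fst e) - \<phi> (snd e)"
    by (rule exists_pos_scaling[of "arcs \<G>" "\<lambda>e. \<phi> (fst e) - \<phi> (snd e)" "\<lambda>e. \<psi> (fst e) - \<psi> (snd e)"])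
      (use \<phi>_decreasing in auto)
  \<comment> \<open>A chord flow \<open>y\<close> from \<open>u\<close> to \<open>v\<close> takes
    that amount off the grid's task, which superimposes the dipole potential with factor
    \<open>- y\<close>.\<close>
  define \<rho> where "\<rho> w = \<phi> w - y * \<psi> w" for w
  \<comment> \<open>As the level gain is an integer and at least 1, this \<open>b\<close> outweighs
    the drop of \<rho> across the chord and keeps \<open>d\<close> nonnegative.\<close>
  define b where "b = \<bar>\<rho> u - \<rho> v\<bar>"
  define \<pi> where "\<pi> w = \<rho> w - b * real (level w)" for w
  \<comment> \<open>With slope 0, this constant makes the chord latency equal to the potential drop
    across the chord.\<close>
  define d where "d = \<pi> u - \<pi> v"
  define f where "f e = (if e = (u, v) then y else (\<rho> (fst e) - \<rho> (snd e)) / a)" for e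
  have b: "b \<ge> 0"
    by (simp add: b_def)
  have "b * 1 \<le> b * real_of_int (level_gain u v)"
    using b k by (intro mult_left_mono) auto
  also have "\<dots> = d - (\<rho> u - \<rho> v)"
    by (simp add: d_def \<pi>_def level_gain_def algebra_simps)
  finally have d: "d \<ge> 0"
    by (simp add: b_def)
  interpret affine_network \<G>' "(0, 0)" "(m, n)" q
    "\<lambda>e. if e = (u, v) then 0 else a" "\<lambda>e. if e = (u, v) then d else b"
    using b d by (intro new_network) auto
  have "feasible_flow \<G>' (0, 0) (m, n) q f"
  proof (rule feasible_flowI)
    fix e assume "e \<in> arcs \<G>'"
    then show "f e \<ge> 0"
      using small[of e] y a by (auto simp: f_def \<rho>_def algebra_simps)
  next
    fix w assume w: "w \<in> verts \<G>"
    have "net_outflow \<G> f w = stencil m n \<rho> w / a"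
      using w by (rule net_outflow_potential) (auto simp: f_def dest: arc_not_chord)
    also have "stencil m n \<rho> w = stencil m n \<phi> w - y * stencil m n \<psi> w"
      by (simp add: stencil_def \<rho>_def algebra_simps split: prod.split)
    also have "\<dots> = a * (q * (of_bool (w = (0, 0)) - of_bool (w = (m, n))) -
        y * (of_bool (w = u) - of_bool (w = v)))"
      using w by (simp add: stencil_\<phi> stencil_dipole_potential a u v algebra_simps)
    finally have "net_outflow \<G> f w = q * (of_bool (w = (0, 0)) - of_bool (w = (m, n))) -
        y * (of_bool (w = u) - of_bool (w = v))"
      using a by simp
    moreover have "f (u, v) = y"
      by (simp add: f_def)
    ultimately show "net_outflow \<G>' f w = q * (of_bool (w = (0, 0)) - of_bool (w = (m, n)))"
      unfolding net_outflow_chord[OF w] eq_commute[of u w] eq_commute[of v w]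
      by (simp only: diff_add_cancel)
  qed simp
  then have "equilibrium_cost \<G>' latency (0, 0) (m, n) q = q * (\<pi> (0, 0) - \<pi> (m, n))"
  proof (rule potential_flow_cost)
    fix e assume "e \<in> arcs \<G>'"
    then consider "e = (u, v)" | "e \<in> arcs \<G>" "e \<noteq> (u, v)"
      using arc_not_chord by auto
    then show "latency e (f e) = \<pi> (tail \<G>' e) - \<pi> (head \<G>' e)"
    proof cases
      case 1
      then show ?thesis by (simp add: latency_def d_def)
    next
      case 2
      then have "a * f e = \<rho> (fst e) - \<rho> (snd e)"
        using a by (simp add: f_def)
      with 2 show ?thesis
        by (simp add: latency_def \<pi>_def level_head_grid algebra_simps)
    qed
  qed
  \<comment> \<open>By reciprocity the drop of \<psi> from source to sink, times \<open>q\<close>,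
    is the chord voltage.\<close>
  then have "cost_new b 0 d = cost_old b - y * chord_voltage m n a q u v"
    using new_latency[OF b order_refl d]
    by (simp add: cost_old_eq[OF b] voltage(2) \<pi>_def \<rho>_def level_def algebra_simps)
  moreover have "y * chord_voltage m n a q u v < 0"
    using y V by (simp add: mult_pos_neg)
  ultimately have "cost_new b 0 d > cost_old b"
    by simp
  then show ?thesis
    unfolding braess_capable_def using b d braess_ratio_gt_1_iff[OF b] by blast
qed

end

theorem theorem2p15:
  fixes m n :: nat and a q :: real and u v :: "nat \<times> nat"
  assumes "m \<ge> 1" and "n \<ge> 1"
    and "a > 0" and "q > 0"
    and "is_chord m n u v"
  shows "braess_capable m n a q u v \<longleftrightarrow>
    chord_voltage m n a q u v < 0 \<and> level_gain u v > 0"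
proof -
  interpret chord_grid m n a q u v
    using assms by unfold_locales
  show ?thesis
    using braess_capable_imp braess_capableI by blast
qed

end
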